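(* Let $\mathbf{G}$ be a GLUE-scheme with spread $n$, and let $\mathbf{P}\in\mathbb{E}^{\ge n}$. Let $\alpha\in(0,1]$. (i) If $\mathbf{P}$ is straightened by $\mathbf{G}$, then $\mathbf{G}$ is convergent at $\mathbf{P}$. (ii) If $\mathbf{P}$ is strongly straightened by $\mathbf{G}$, then $\mathbf{G}$ is $C^1$ at $\mathbf{P}$. (iii) If $\mathbf{P}$ is straightened by $\mathbf{G}$ at rate $\alpha$, then $\mathbf{G}$ is $C^{1,\alpha}$ at $\mathbf{P}$.
   Context: **Chains.** Fix $d\in\mathbb{N}=\{1,2,\dots\}$ and let $\mathbb{E}:=\mathbb{R}^d$ with Euclidean norm $\|\cdot\|$; points are row vectors. $\mathbb{E}^N$ is the set of chains $\mathbf{P}=[p_0;\dots;p_{N-1}]$ of $N$ points $p_i\in\mathbb{E}$; $\#\mathbf{P}:=N$; $\mathbb{E}^{\ge n}:=\bigcup_{N\ge n}\mathbb{E}^N$. Subchains: $T^n_i\mathbf{P}:=[p_i;\dots;p_{i+n-1}]$, $0\le i\le\#\mathbf{P}-n$, and $T^n\mathbf{P}$ is the set of all of these. Let $e:=[1,0,\dots,0]\in\mathbb{E}$, $\mathbf{E}_N:=[e;2e;\dots;Ne]$ and $\mathbf{e}:=\mathbf{E}_n$. Forward differences: $(\Delta\mathbf{P})_i:=p_{i+1}-p_i$, with iterates $\Delta^k$. Set $|\mathbf{P}|_0:=\max_i\|p_i\|$ and $|\mathbf{P}|_j:=|\Delta^j\mathbf{P}|_0$. Let $\mathbb{L}^n:=\{\mathbf{p}\in\mathbb{E}^n:\Delta^2\mathbf{p}=0\}$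 and let $\Pi:\mathbb{E}^n\to\mathbb{L}^n$ be the orthogonal projection with respect to $\langle\mathbf{p},\mathbf{q}\rangle_n=\sum_i\langle p_i,q_i\rangle$. The relative distortion of $\mathbf{p}\in\mathbb{E}^n$ is $\kappa(\mathbf{p}):=|\mathbf{p}|_2/|\Pi\mathbf{p}|_1$ if $\Delta\Pi\mathbf{p}\ne0$ and $\kappa(\mathbf{p}):=\infty$ otherwise; for $\mathbf{P}\in\mathbb{E}^{\ge n}$, $\kappa(\mathbf{P}):=\max\{\kappa(\mathbf{p}):\mathbf{p}\in T^n\mathbf{P}\}$. A similarity is a map $S(p)=\varrho pQ+s$ with $\varrho>0$, $Q\in\mathbb{R}^{d\times d}$ orthogonal, $s\in\mathbb{E}$; it acts on chains pointwise. **GLUE-schemes.** Let $m\in\mathbb{N}$ and $n=2m+1$. A map $\mathbf{G}:\mathbb{E}^{\ge n}\to\mathbb{E}^{\ge n}$ with $\#\mathbf{G}(\mathbf{P})=2\#\mathbf{P}-n+1$ is a GLUE-scheme with spread $n$ if: (G) $\mathbf{G}\circ S=S\circ\mathbf{G}$ for all similarities $S$; (L),(U) there are functions $g_0,g_1:\mathbb{E}^{m+1}\to\mathbb{E}$ such that $\mathbf{P}'=\mathbf{G}(\mathbf{P})$ has points $p'_{2i+\lambda}=g_\lambda(p_i,\dots,p_{i+m})$ for $\lambda\in\{0,1\}$, $0\le i<\#\mathbf{P}-m$, and $g_0,g_1$ are $C^{1,\nu}$ in a neighborhood of $\mathbf{E}_{m+1}$ for some $\nu>0$ (the regularity parameter);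 (E) $\mathbf{G}(\mathbf{e})=(\mathbf{E}_{n+1}+(m+\tau)e)/2$ for some $\tau\in[0,1)$ (the shift), where $(m+\tau)e$ is added to every point. Write $\mathbf{P}^\ell:=\mathbf{G}^\ell(\mathbf{P})$ with points $p^\ell_i$. **Straightening.** Let $\kappa_\ell(\mathbf{P}):=\kappa(\mathbf{P}^\ell)$, $\ell\in\mathbb{N}$. A sequence in $\mathbb{R}\cup\{\infty\}$ is essentially bounded (essentially summable) if it has only finitely many infinite values and is bounded (summable) beyond some index. The chain $\mathbf{P}\in\mathbb{E}^{\ge n}$ is straightened by $\mathbf{G}$ if $(\kappa_\ell(\mathbf{P}))_\ell$ is a null sequence (finitely many infinite values allowed); strongly straightened by $\mathbf{G}$ if $(\kappa_\ell(\mathbf{P}))_\ell$ is essentially summable; straightened by $\mathbf{G}$ at rate $\alpha\in(0,1]$ if $(2^{\ell\alpha}\kappa_\ell(\mathbf{P}))_\ell$ is essentially bounded. **Limit curves and regularity.** For $N=\#\mathbf{P}$ let $I:=(0,N-n+1)$, $I_z:=[z,N-n+1-z]$ for $z>0$, $I^\ell_z:=\mathbb{N}\cap2^\ell I_z$, and $|\Phi|_z:=\max_{t\in I_z}\|\Phi(t)\|$. $\mathbf{G}$ is convergent at $\mathbf{P}$ if there is a continuous limit curve $\Phi[\mathbf{P}]:\mathbb{R}\to\mathbb{E}$ with $\lim_{\ell\to\infty}\sup_{i\in I^\ell_z}\|\Phi[\mathbf{P}](2^{-\ell}i)-p^\ell_i\|=0$ for every $z>0$. A curve $\Phi$ is $C^k$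 if its $k$-th derivative $\partial^k\Phi$ exists and is continuous on $I$; it is $C^{k,\alpha}$ if moreover, for some $h_0>0$ and every $z>0$, $\sup_{0<h\le h_0}h^{-\alpha}\omega_z(\partial^k\Phi,h)<\infty$, where $\omega_z(\Psi,h):=|\Psi(\cdot+h/2)-\Psi(\cdot-h/2)|_{z+h/2}$. $\mathbf{G}$ is $C^k$ (resp. $C^{k,\alpha}$) at $\mathbf{P}$ if it is convergent at $\mathbf{P}$ and $\Phi[\mathbf{P}]$ is $C^k$ (resp. $C^{k,\alpha}$). *)

theory Defs
  imports "HOL-Analysis.Analysis"
begin

text \<open>
  A chain of \<open>N\<close> points is a list of length \<open>N\<close>.  The ambient space is \<open>real ^ 'd\<close>; the
  coordinates are ordered through \<open>'d :: linorder\<close>, so that ``the first unit vector'' makes sense.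
  The maxima and suprema of norms over intervals \<open>I_z\<close> and index sets \<open>I_z^l\<close>, which are empty
  for large \<open>z\<close>, are taken in \<open>ennreal\<close>, where the supremum of the empty set is \<open>0\<close>.
\<close>

definition subchain :: "nat \<Rightarrow> nat \<Rightarrow> 'a list \<Rightarrow> 'a list" where
  "subchain k i P = take k (drop i P)"

definition subchains :: "nat \<Rightarrow> 'a list \<Rightarrow> 'a list set" where
  "subchains k P = {subchain k i P | i. i + k \<le> length P}"

definition fdiff :: "'a::ab_group_add list \<Rightarrow> 'a list" where
  "fdiff P = map (\<lambda>i. P ! Suc i - P ! i) [0..<length P - 1]"

text \<open>Only meaningful if the \<open>j\<close>-th difference chain is nonempty, that is, \<open>j < length P\<close>.\<close>

definition chain_norm :: "nat \<Rightarrow> 'a::real_normed_vector list \<Rightarrow> real" where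
  "chain_norm j P = Max (norm ` set ((fdiff ^^ j) P))"

definition chain_minus :: "'a::ab_group_add list \<Rightarrow> 'a list \<Rightarrow> 'a list" where
  "chain_minus p q = map2 (-) p q"

definition chain_inner :: "'a::real_inner list \<Rightarrow> 'a list \<Rightarrow> real" where
  "chain_inner p q = (\<Sum>i<length p. p ! i \<bullet> q ! i)"

definition linear_chains :: "nat \<Rightarrow> 'a::ab_group_add list set" where
  "linear_chains N = {p. length p = N \<and> (\<forall>x \<in> set ((fdiff ^^ 2) p). x = 0)}"

definition linear_proj :: "'a::real_inner list \<Rightarrow> 'a list" where
  "linear_proj p = (THE q. q \<in> linear_chains (length p) \<and>
     (\<forall>r \<in> linear_chains (length p). chain_inner (chain_minus p q) r = 0))"

definition rel_distortion :: "'a::real_inner list \<Rightarrow> ereal" where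
  "rel_distortion p =
     (if \<exists>x \<in> set (fdiff (linear_proj p)). x \<noteq> 0
      then ereal (chain_norm 2 p / chain_norm 1 (linear_proj p)) else \<infinity>)"

definition distortion :: "nat \<Rightarrow> 'a::real_inner list \<Rightarrow> ereal" where
  "distortion n P = Max (rel_distortion ` subchains n P)"

definition first_unit :: "real ^ 'd::{finite,linorder}" where
  "first_unit = axis (Min UNIV) 1"

definition unit_chain :: "nat \<Rightarrow> (real ^ 'd::{finite,linorder}) list" where
  "unit_chain N = map (\<lambda>i. real (i + 1) *\<^sub>R first_unit) [0..<N]"

definition similarity :: "(real ^ 'd::finite \<Rightarrow> real ^ 'd::finite) \<Rightarrow> bool" where
  "similarity S \<longleftrightarrow> (\<exists>\<rho> Q s. \<rho> > 0 \<and> orthogonal_matrix Q \<and> S = (\<lambda>p. \<rho> *\<^sub>R (p v* Q) + s))"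

text \<open>
  Frechet differentiability of a function on chains of fixed length, with respect to the maximum
  norm.  The length is not a type, so the derivative, a linear map on chains of length \<open>N\<close>,
  is given by its \<open>N\<close> blocks \<open>A i\<close>.
\<close>

definition chain_has_derivative ::
  "('a::real_normed_vector list \<Rightarrow> 'b::real_normed_vector) \<Rightarrow> (nat \<Rightarrow> 'a \<Rightarrow>\<^sub>L 'b) \<Rightarrow> 'a list \<Rightarrow> bool" where
  "chain_has_derivative g A p \<longleftrightarrow>
     (\<forall>\<epsilon>>0. \<exists>\<delta>>0. \<forall>q. length q = length p \<and> chain_norm 0 (chain_minus q p) < \<delta> \<longrightarrow>
        norm (g q - g p - (\<Sum>i<length p. blinfun_apply (A i) (q ! i - p ! i)))
          \<le> \<epsilon> * chain_norm 0 (chain_minus q p))"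

definition C1_hoelder_near ::
  "real \<Rightarrow> ('a::real_normed_vector list \<Rightarrow> 'b::real_normed_vector) \<Rightarrow> 'a list \<Rightarrow> bool" where
  "C1_hoelder_near \<nu> g c \<longleftrightarrow>
     (\<exists>r>0. \<exists>D C. let U = {p. length p = length c \<and> chain_norm 0 (chain_minus p c) < r} in
        (\<forall>p\<in>U. chain_has_derivative g (D p) p) \<and>
        (\<forall>p\<in>U. \<forall>q\<in>U. \<forall>i<length c.
           norm (D p i - D q i) \<le> C * chain_norm 0 (chain_minus p q) powr \<nu>))"

text \<open>
  A scheme is a total function on lists, of which only the values on chains of length at
  least \<open>n\<close> matter; likewise \<open>g0\<close>, \<open>g1\<close> matter only on chains of length \<open>m + 1\<close>.
\<close>

definition glue_scheme ::
  "nat \<Rightarrow> ((real ^ 'd::{finite,linorder}) list \<Rightarrow> (real ^ 'd::{finite,linorder}) list) \<Rightarrow> bool" where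
  "glue_scheme n G \<longleftrightarrow>
     (\<exists>m \<tau> \<nu> g0 g1. m \<ge> 1 \<and> n = 2 * m + 1 \<and> 0 \<le> \<tau> \<and> \<tau> < 1 \<and> \<nu> > 0 \<and>
       (\<forall>P. n \<le> length P \<longrightarrow> length (G P) = 2 * length P - n + 1) \<and>
       (\<forall>S P. similarity S \<and> n \<le> length P \<longrightarrow> G (map S P) = map S (G P)) \<and>
       (\<forall>P i. n \<le> length P \<and> i < length P - m \<longrightarrow>
          G P ! (2 * i) = g0 (subchain (m + 1) i P) \<and>
          G P ! (2 * i + 1) = g1 (subchain (m + 1) i P)) \<and>
       C1_hoelder_near \<nu> g0 (unit_chain (m + 1)) \<and>
       C1_hoelder_near \<nu> g1 (unit_chain (m + 1)) \<and>
       G (unit_chain n) =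
         map (\<lambda>p. (1/2) *\<^sub>R (p + (real m + \<tau>) *\<^sub>R first_unit)) (unit_chain (n + 1)))"

definition essentially_bounded :: "(nat \<Rightarrow> ereal) \<Rightarrow> bool" where
  "essentially_bounded x \<longleftrightarrow> finite {l. x l = \<infinity>} \<and>
     (\<exists>L. (\<forall>l\<ge>L. x l \<noteq> \<infinity>) \<and> bounded ((\<lambda>l. real_of_ereal (x l)) ` {L..}))"

definition essentially_summable :: "(nat \<Rightarrow> ereal) \<Rightarrow> bool" where
  "essentially_summable x \<longleftrightarrow> finite {l. x l = \<infinity>} \<and>
     (\<exists>L. (\<forall>l\<ge>L. x l \<noteq> \<infinity>) \<and> summable (\<lambda>l. real_of_ereal (x (l + L))))"

text \<open>
  The sequence of distortions also contains the term for \<open>l = 0\<close>, the initial chain; the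
  properties below do not depend on finitely many terms.
\<close>

definition kappa_seq :: "nat \<Rightarrow> ('a::real_inner list \<Rightarrow> 'a list) \<Rightarrow> 'a list \<Rightarrow> nat \<Rightarrow> ereal" where
  "kappa_seq n G P l = distortion n ((G ^^ l) P)"

definition straightened :: "nat \<Rightarrow> ('a::real_inner list \<Rightarrow> 'a list) \<Rightarrow> 'a list \<Rightarrow> bool" where
  "straightened n G P \<longleftrightarrow> kappa_seq n G P \<longlonglongrightarrow> 0"

definition strongly_straightened :: "nat \<Rightarrow> ('a::real_inner list \<Rightarrow> 'a list) \<Rightarrow> 'a list \<Rightarrow> bool" where
  "strongly_straightened n G P \<longleftrightarrow> essentially_summable (kappa_seq n G P)"

definition straightened_at_rate ::
  "real \<Rightarrow> nat \<Rightarrow> ('a::real_inner list \<Rightarrow> 'a list) \<Rightarrow> 'a list \<Rightarrow> bool" where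
  "straightened_at_rate \<alpha> n G P \<longleftrightarrow>
     essentially_bounded (\<lambda>l. ereal (2 powr (real l * \<alpha>)) * kappa_seq n G P l)"

text \<open>Below, \<open>w = N - n + 1\<close> is the length of the parameter interval \<open>I = (0, w)\<close>.\<close>

definition param_width :: "nat \<Rightarrow> 'a list \<Rightarrow> real" where
  "param_width n P = real (length P) - real n + 1"

definition param_indices :: "real \<Rightarrow> nat \<Rightarrow> real \<Rightarrow> nat set" where
  "param_indices w l z = {i. 1 \<le> i \<and> real i \<in> (\<lambda>t. 2 ^ l * t) ` {z..w - z}}"

definition limit_curve ::
  "nat \<Rightarrow> ('a::real_normed_vector list \<Rightarrow> 'a list) \<Rightarrow> 'a list \<Rightarrow> (real \<Rightarrow> 'a) \<Rightarrow> bool" where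
  "limit_curve n G P \<Phi> \<longleftrightarrow> continuous_on UNIV \<Phi> \<and>
     (\<forall>z>0. (\<lambda>l. SUP i \<in> param_indices (param_width n P) l z.
                 ennreal (norm (\<Phi> (real i / 2 ^ l) - ((G ^^ l) P) ! i))) \<longlonglongrightarrow> 0)"

definition convergent_at ::
  "nat \<Rightarrow> ('a::real_normed_vector list \<Rightarrow> 'a list) \<Rightarrow> 'a list \<Rightarrow> bool" where
  "convergent_at n G P \<longleftrightarrow> (\<exists>\<Phi>. limit_curve n G P \<Phi>)"

definition curve_norm :: "real \<Rightarrow> real \<Rightarrow> (real \<Rightarrow> 'a::real_normed_vector) \<Rightarrow> ennreal" where
  "curve_norm w z \<Phi> = (SUP t \<in> {z..w - z}. ennreal (norm (\<Phi> t)))"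

definition modulus ::
  "real \<Rightarrow> real \<Rightarrow> (real \<Rightarrow> 'a::real_normed_vector) \<Rightarrow> real \<Rightarrow> ennreal" where
  "modulus w z \<Psi> h = curve_norm w (z + h/2) (\<lambda>t. \<Psi> (t + h/2) - \<Psi> (t - h/2))"

definition curve_deriv :: "nat \<Rightarrow> (real \<Rightarrow> 'a::real_normed_vector) \<Rightarrow> real \<Rightarrow> 'a" where
  "curve_deriv k = (\<lambda>f t. vector_derivative f (at t)) ^^ k"

definition curve_C :: "real \<Rightarrow> nat \<Rightarrow> (real \<Rightarrow> 'a::real_normed_vector) \<Rightarrow> bool" where
  "curve_C w k \<Phi> \<longleftrightarrow>
     (\<forall>j<k. \<forall>t\<in>{0<..<w}. curve_deriv j \<Phi> differentiable (at t)) \<and>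
     continuous_on {0<..<w} (curve_deriv k \<Phi>)"

definition curve_C_hoelder :: "real \<Rightarrow> nat \<Rightarrow> real \<Rightarrow> (real \<Rightarrow> 'a::real_normed_vector) \<Rightarrow> bool" where
  "curve_C_hoelder w k \<alpha> \<Phi> \<longleftrightarrow> curve_C w k \<Phi> \<and>
     (\<exists>h0>0. \<forall>z>0.
        (SUP h \<in> {0<..h0}. ennreal (h powr (- \<alpha>)) * modulus w z (curve_deriv k \<Phi>) h) < \<infinity>)"

text \<open>
  A limit curve is unique on the open parameter interval, and the regularity classes depend
  only on its values there, so ``some limit curve'' and ``the limit curve'' agree.
\<close>

definition C_at :: "nat \<Rightarrow> nat \<Rightarrow> ('a::real_normed_vector list \<Rightarrow> 'a list) \<Rightarrow> 'a list \<Rightarrow> bool" where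
  "C_at k n G P \<longleftrightarrow> (\<exists>\<Phi>. limit_curve n G P \<Phi> \<and> curve_C (param_width n P) k \<Phi>)"

definition C_hoelder_at ::
  "nat \<Rightarrow> real \<Rightarrow> nat \<Rightarrow> ('a::real_normed_vector list \<Rightarrow> 'a list) \<Rightarrow> 'a list \<Rightarrow> bool" where
  "C_hoelder_at k \<alpha> n G P \<longleftrightarrow>
     (\<exists>\<Phi>. limit_curve n G P \<Phi> \<and> curve_C_hoelder (param_width n P) k \<alpha> \<Phi>)"

end

theory Submission imports Defs begin

text \<open>
  A chain \<open>p\<close> with finite relative distortion \<open>\<kappa>\<close> differs from a linear chain with step \<open>v\<close> by
  \<open>O(\<kappa> \<bar>v\<bar>)\<close>.  By equivariance under similarities such a chain is a copy, scaled by \<open>\<bar>v\<bar>\<close>, of a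
  chain at distance \<open>O(\<kappa>)\<close> from the unit chain, where the local rules are known exactly and are
  Lipschitz.  Hence one step of the scheme halves the differences up to a relative error \<open>O(\<kappa>)\<close>,
  and neighbouring differences agree up to the same relative error.

  If \<open>\<kappa>\<^sub>l \<longrightarrow> 0\<close>, the differences decay geometrically and the step functions \<open>t \<mapsto> p\<^sup>l\<close> at index
  \<open>\<lfloor>2^l t\<rfloor>\<close> converge uniformly.  If \<open>\<kappa>\<close> is summable, the differences scaled by \<open>2^l\<close> stay bounded
  and their step functions converge uniformly as well; the limit is the derivative of the curve,
  and its modulus of continuity is controlled by the tails of \<open>\<Sum> \<kappa>\<^sub>l\<close>.
\<close>

section \<open>Linear chains and relative distortion\<close>

lemma length_fdiff [simp]: "length (fdiff P) = length P - 1"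
  by (simp add: fdiff_def)

lemma nth_fdiff: "Suc i < length P \<Longrightarrow> fdiff P ! i = P ! Suc i - P ! i"
  by (simp add: fdiff_def less_diff_conv)

lemma nth_fdiff2: "Suc (Suc i) < length P \<Longrightarrow>
    (fdiff ^^ 2) P ! i = P ! Suc (Suc i) - P ! Suc i - (P ! Suc i - P ! i)"
  by (simp add: numeral_2_eq_2 nth_fdiff)

lemma length_fdiff2: "length ((fdiff ^^ 2) P) = length P - 2"
  by (simp add: numeral_2_eq_2)

lemma norm_nth_le_chain_norm_0: "i < length p \<Longrightarrow> norm (p ! i) \<le> chain_norm 0 p"
  by (auto simp: chain_norm_def intro!: Max_ge)

lemma chain_norm_0_le:
  assumes "0 < length p" "\<And>i. i < length p \<Longrightarrow> norm (p ! i) \<le> b"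
  shows "chain_norm 0 p \<le> b"
  using assms by (auto simp: chain_norm_def in_set_conv_nth)

lemma linear_chainsI:
  fixes a v :: "'a::real_vector"
  shows "map (\<lambda>j. a + real j *\<^sub>R v) [0..<N] \<in> linear_chains N"
  unfolding linear_chains_def
  by (auto simp: in_set_conv_nth nth_fdiff2 length_fdiff2 algebra_simps)
    (simp only: scaleR_2)

lemma linear_chainsE:
  fixes p :: "'a::real_vector list"
  assumes "p \<in> linear_chains N"
  obtains a v where "p = map (\<lambda>j. a + real j *\<^sub>R v) [0..<N]"
proof -
  have len: "length p = N" using assms by (simp add: linear_chains_def)
  have step: "p ! Suc (Suc i) - p ! Suc i = p ! Suc i - p ! i" if "Suc (Suc i) < N" for i
  proof -
    have "(fdiff ^^ 2) p ! i \<in> set ((fdiff ^^ 2) p)"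
      using that len by (intro nth_mem) (simp add: length_fdiff2)
    then show ?thesis using assms that len by (auto simp: linear_chains_def nth_fdiff2)
  qed
  have diff: "p ! Suc i - p ! i = p ! Suc 0 - p ! 0" if "Suc i < N" for i
    using that by (induction i) (auto simp: step)
  define v where "v = p ! Suc 0 - p ! 0"
  define a where "a = p ! 0"
  have "p ! i = a + real i *\<^sub>R v" if "i < N" for i
    using that
  proof (induction i)
    case (Suc i)
    then have "p ! i = a + real i *\<^sub>R v" by (meson Suc_lessD)
    then have "p ! Suc i = v + (a + real i *\<^sub>R v)"
      using diff[OF Suc.prems] unfolding v_def by (metis diff_eq_eq)
    then show ?case by (simp add: scaleR_left_distrib)
  qed (simp add: a_def)
  then have "p = map (\<lambda>j. a + real j *\<^sub>R v) [0..<N]"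
    using len by (intro nth_equalityI) auto
  then show thesis by (rule that)
qed

lemma chain_inner_self_eq_0:
  "chain_inner p p = 0 \<longleftrightarrow> (\<forall>i<length p. p ! i = 0)"
  by (auto simp: chain_inner_def sum_nonneg_eq_0_iff)

lemma chain_minus_nth: "i < length p \<Longrightarrow> i < length q \<Longrightarrow> chain_minus p q ! i = p ! i - q ! i"
  by (simp add: chain_minus_def)

lemma length_chain_minus [simp]: "length (chain_minus p q) = min (length p) (length q)"
  by (simp add: chain_minus_def)

text \<open>Centring the indices at their mean decouples the normal equations.\<close>

lemma linear_proj_exists:
  fixes p :: "'a::real_inner list"
  assumes "2 \<le> length p"
  shows "\<exists>q. q \<in> linear_chains (length p) \<and>
     (\<forall>r \<in> linear_chains (length p). chain_inner (chain_minus p q) r = 0)"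
proof -
  define N where "N = length p"
  define c where "c j = real j - (real N - 1) / 2" for j
  define Q where "Q = (\<Sum>j<N. c j ^ 2)"
  define b where "b = (\<Sum>j<N. p ! j) /\<^sub>R real N"
  define v where "v = (\<Sum>j<N. c j *\<^sub>R p ! j) /\<^sub>R Q"
  define q where "q = map (\<lambda>j. (b - ((real N - 1) / 2) *\<^sub>R v) + real j *\<^sub>R v) [0..<N]"
  have N2: "2 \<le> N" using assms by (simp add: N_def)
  have sumc: "(\<Sum>j<N. c j) = 0"
  proof -
    have "2 * (\<Sum>j<M. real j) = real M * (real M - 1)" for M
      by (induction M) (auto simp: algebra_simps)
    from this[of N] have "(\<Sum>j<N. real j) = real N * ((real N - 1) / 2)" by simp
    then show ?thesis unfolding c_def sum_subtractf by simp
  qed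
  have "c 0 ^ 2 \<le> Q" unfolding Q_def using N2 by (intro member_le_sum) auto
  \<comment> \<open>At least two indices are needed here: a single centred index is
    \<open>0\<close>, and then no equation would determine the slope \<open>v\<close>.\<close>
  moreover have "c 0 \<noteq> 0" using N2 by (simp add: c_def)
  ultimately have Q: "Q \<noteq> 0" by (smt (verit) zero_less_power2)
  have qn: "q ! j = b + c j *\<^sub>R v" if "j < N" for j
    using that by (simp add: q_def c_def algebra_simps)
  \<comment> \<open>\<open>e1\<close> and \<open>e2\<close> are the normal equations: the residual
    pairs to zero with the constants and with the centred indices, which together span the linear
    chains.\<close>
  have e1: "(\<Sum>j<N. p ! j - q ! j) = 0"
  proof -
    have "(\<Sum>j<N. p ! j - q ! j) = (\<Sum>j<N. p ! j) - (\<Sum>j<N. b + c j *\<^sub>R v)"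
      by (simp add: sum_subtractf qn)
    also have "(\<Sum>j<N. b + c j *\<^sub>R v) = real N *\<^sub>R b + (\<Sum>j<N. c j) *\<^sub>R v"
      by (simp add: sum.distrib scaleR_sum_left sum_constant_scaleR)
    also have "\<dots> = (\<Sum>j<N. p ! j)" using N2 by (simp add: sumc b_def)
    finally show ?thesis by simp
  qed
  have e2: "(\<Sum>j<N. c j *\<^sub>R (p ! j - q ! j)) = 0"
  proof -
    have "(\<Sum>j<N. c j *\<^sub>R (p ! j - q ! j)) =
        (\<Sum>j<N. c j *\<^sub>R p ! j) - (\<Sum>j<N. c j *\<^sub>R b + c j ^ 2 *\<^sub>R v)"
      unfolding sum_subtractf[symmetric]
      by (intro sum.cong) (auto simp: qn algebra_simps power2_eq_square)
    also have "(\<Sum>j<N. c j *\<^sub>R b + c j ^ 2 *\<^sub>R v) = (\<Sum>j<N. c j) *\<^sub>R b + Q *\<^sub>R v"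
      by (simp add: sum.distrib scaleR_sum_left Q_def)
    also have "\<dots> = (\<Sum>j<N. c j *\<^sub>R p ! j)" using Q by (simp add: sumc v_def)
    finally show ?thesis by simp
  qed
  have "q \<in> linear_chains N" unfolding q_def by (rule linear_chainsI)
  moreover have "chain_inner (chain_minus p q) r = 0" if r: "r \<in> linear_chains N" for r
  proof -
    obtain a u where r_eq: "r = map (\<lambda>j. a + real j *\<^sub>R u) [0..<N]"
      using r by (rule linear_chainsE)
    define a' where "a' = a + ((real N - 1) / 2) *\<^sub>R u"
    have rn: "r ! j = a' + c j *\<^sub>R u" if "j < N" for j
      using that by (simp add: r_eq a'_def c_def algebra_simps)
    have "chain_inner (chain_minus p q) r = (\<Sum>j<N. (p ! j - q ! j) \<bullet> (a' + c j *\<^sub>R u))"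
      by (auto simp: chain_inner_def N_def q_def chain_minus_nth rn[unfolded N_def] intro!: sum.cong)
    also have "\<dots> = (\<Sum>j<N. p ! j - q ! j) \<bullet> a' + (\<Sum>j<N. c j *\<^sub>R (p ! j - q ! j)) \<bullet> u"
      by (simp add: inner_add_right inner_sum_left sum.distrib)
    finally show ?thesis by (simp add: e1 e2)
  qed
  ultimately show ?thesis unfolding N_def by blast
qed

text \<open>Two solutions of the normal equations differ by a linear chain that is orthogonal to
  itself, hence by zero. So the description that defines \<open>linear_proj\<close> denotes.\<close>

lemma linear_proj:
  fixes p :: "'a::real_inner list"
  assumes "2 \<le> length p"
  shows linear_proj_in: "linear_proj p \<in> linear_chains (length p)"
    and linear_proj_orthogonal:
      "r \<in> linear_chains (length p) \<Longrightarrow> chain_inner (chain_minus p (linear_proj p)) r = 0"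
proof -
  let ?P = "\<lambda>q. q \<in> linear_chains (length p) \<and>
     (\<forall>r \<in> linear_chains (length p). chain_inner (chain_minus p q) r = 0)"
  obtain q where q: "?P q" using linear_proj_exists[OF assms] by blast
  have "q' = q" if q': "?P q'" for q'
  proof -
    have len: "length q = length p" "length q' = length p"
      using q q' by (auto simp: linear_chains_def)
    obtain a v where qe: "q = map (\<lambda>j. a + real j *\<^sub>R v) [0..<length p]"
      using q linear_chainsE by blast
    obtain a' v' where qe': "q' = map (\<lambda>j. a' + real j *\<^sub>R v') [0..<length p]"
      using q' linear_chainsE by blast
    let ?d = "chain_minus q' q"
    have d: "?d = map (\<lambda>j. (a' - a) + real j *\<^sub>R (v' - v)) [0..<length p]"
      unfolding qe qe' by (intro nth_equalityI) (auto simp: chain_minus_nth algebra_simps)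
    have "?d \<in> linear_chains (length p)" unfolding d by (rule linear_chainsI)
    then have "chain_inner (chain_minus p q) ?d - chain_inner (chain_minus p q') ?d = 0"
      using q q' by simp
    moreover have "chain_inner (chain_minus p q) ?d - chain_inner (chain_minus p q') ?d
        = chain_inner ?d ?d"
      using len by (simp add: chain_inner_def sum_subtractf[symmetric] chain_minus_nth algebra_simps)
    ultimately have "\<forall>i<length p. q' ! i - q ! i = 0"
      using len by (simp add: chain_inner_self_eq_0 chain_minus_nth)
    then show ?thesis using len by (intro nth_equalityI) auto
  qed
  then have "?P (linear_proj p)"
    unfolding linear_proj_def using q by (intro theI[of ?P]) auto
  then show "linear_proj p \<in> linear_chains (length p)"
    and "r \<in> linear_chains (length p) \<Longrightarrow> chain_inner (chain_minus p (linear_proj p)) r = 0"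
    by blast+
qed

text \<open>Pythagoras: \<open>q - r\<close> is linear, so the residual \<open>p - q\<close> is
  orthogonal to it. This lets any explicit linear chain bound the distance to the
  projection.\<close>

lemma linear_proj_least_squares:
  fixes p :: "'a::real_inner list"
  assumes "2 \<le> length p" and r: "r \<in> linear_chains (length p)"
  shows "(\<Sum>i<length p. norm (p ! i - linear_proj p ! i) ^ 2) \<le> (\<Sum>i<length p. norm (p ! i - r ! i) ^ 2)"
proof -
  define q where "q = linear_proj p"
  have q: "q \<in> linear_chains (length p)" using linear_proj_in[OF assms(1)] by (simp add: q_def)
  have len: "length q = length p" "length r = length p"
    using q r by (auto simp: linear_chains_def)
  have "chain_inner (chain_minus p q) q = 0" "chain_inner (chain_minus p q) r = 0"
    using linear_proj_orthogonal[OF assms(1)] q r by (auto simp: q_def)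
  then have orth: "(\<Sum>i<length p. (p ! i - q ! i) \<bullet> (q ! i - r ! i)) = 0"
    using len by (simp add: chain_inner_def chain_minus_nth inner_diff_right sum_subtractf)
  have "norm (p ! i - r ! i) ^ 2 = norm (p ! i - q ! i) ^ 2 + norm (q ! i - r ! i) ^ 2
      + 2 * ((p ! i - q ! i) \<bullet> (q ! i - r ! i))" for i
    using dot_norm[of "p ! i - q ! i" "q ! i - r ! i"] by simp
  then have "(\<Sum>i<length p. norm (p ! i - r ! i) ^ 2) = (\<Sum>i<length p. norm (p ! i - q ! i) ^ 2)
      + (\<Sum>i<length p. norm (q ! i - r ! i) ^ 2)"
    using orth by (simp add: sum.distrib sum_distrib_left[symmetric])
  then show ?thesis by (simp add: q_def sum_nonneg)
qed

text \<open>The first difference at index \<open>i\<close> has drifted from the initial one by at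
  most \<open>i * K\<close>; adding up these drifts gives the quadratic factor.\<close>

lemma near_linear_if_fdiff2_bounded:
  fixes p :: "'a::real_normed_vector list"
  assumes K: "\<And>i. Suc (Suc i) < length p \<Longrightarrow>
      norm (p ! Suc (Suc i) - p ! Suc i - (p ! Suc i - p ! i)) \<le> K"
    and K0: "0 \<le> K" and "i < length p"
  shows "norm (p ! i - (p ! 0 + real i *\<^sub>R (p ! Suc 0 - p ! 0))) \<le> real i ^ 2 * K"
proof -
  let ?d = "p ! Suc 0 - p ! 0"
  have diff: "norm (p ! Suc i - p ! i - ?d) \<le> real i * K" if "Suc i < length p" for i
    using that
  proof (induction i)
    case (Suc i)
    have "p ! Suc (Suc i) - p ! Suc i - ?d =
        (p ! Suc i - p ! i - ?d) + (p ! Suc (Suc i) - p ! Suc i - (p ! Suc i - p ! i))" by simp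
    then have "norm (p ! Suc (Suc i) - p ! Suc i - ?d) \<le> real i * K + K"
      using Suc K[of i] by (metis Suc_lessD add_mono norm_triangle_le)
    then show ?case by (simp add: algebra_simps)
  qed simp
  show ?thesis using assms(3)
  proof (induction i)
    case (Suc i)
    have "p ! Suc i - (p ! 0 + real (Suc i) *\<^sub>R ?d) =
        (p ! i - (p ! 0 + real i *\<^sub>R ?d)) + (p ! Suc i - p ! i - ?d)" by (simp add: algebra_simps)
    then have *: "norm (p ! Suc i - (p ! 0 + real (Suc i) *\<^sub>R ?d)) \<le> real i ^ 2 * K + real i * K"
      using Suc diff[of i] by (metis Suc_lessD add_mono norm_triangle_le)
    have "real i ^ 2 * K + real i * K \<le> real (Suc i) ^ 2 * K"
      using K0 by (simp add: algebra_simps power2_eq_square)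
    with * show ?case by linarith
  qed simp
qed

text \<open>The extrapolation \<open>r\<close> of the first two points stays within
  \<open>N ^ 2 * K\<close> of \<open>p\<close>. Least squares transfers this to the projection,
  whose step \<open>v\<close> normalises the distortion; returning from a sum of \<open>N\<close>
  squares to single points costs at most one more factor \<open>N\<close>.\<close>

lemma near_linear_if_rel_distortion:
  fixes p :: "'a::real_inner list"
  assumes n: "3 \<le> length p" and k: "rel_distortion p \<le> ereal k"
  obtains a v where "v \<noteq> 0"
    "\<And>j. j < length p \<Longrightarrow> norm (p ! j - (a + real j *\<^sub>R v)) \<le> real (length p) ^ 3 * k * norm v"
proof -
  define N where "N = length p"
  obtain a v where q: "linear_proj p = map (\<lambda>j. a + real j *\<^sub>R v) [0..<N]"
    using linear_chainsE[OF linear_proj_in[of p]] n N_def by auto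
  \<comment> \<open>All differences of the projection equal \<open>v\<close>, so the denominator of
    the distortion is \<open>norm v\<close>.\<close>
  have "x = v" if "x \<in> set (fdiff (linear_proj p))" for x
    using that by (auto simp: in_set_conv_nth nth_fdiff q algebra_simps)
  moreover have "fdiff (linear_proj p) ! 0 \<in> set (fdiff (linear_proj p))"
    using n by (intro nth_mem) (simp add: q N_def)
  ultimately have set: "set (fdiff (linear_proj p)) = {v}" by auto
  \<comment> \<open>A constant projection has distortion \<open>\<infinity>\<close>, which exceeds
    \<open>ereal k\<close>; this rules out \<open>v = 0\<close>.\<close>
  have v: "v \<noteq> 0" and kap: "chain_norm 2 p / norm v \<le> k"
    using k by (auto simp: rel_distortion_def set chain_norm_def split: if_splits)
  define K where "K = k * norm v"
  have K: "chain_norm 2 p \<le> K" using kap v by (simp add: K_def field_simps)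
  have K2: "norm (p ! Suc (Suc i) - p ! Suc i - (p ! Suc i - p ! i)) \<le> K"
    if "Suc (Suc i) < length p" for i
  proof -
    have "(fdiff ^^ 2) p ! i \<in> set ((fdiff ^^ 2) p)"
      using that by (intro nth_mem) (simp add: length_fdiff2)
    then have "norm ((fdiff ^^ 2) p ! i) \<le> chain_norm 2 p"
      unfolding chain_norm_def by (intro Max_ge) auto
    then show ?thesis using K that by (simp add: nth_fdiff2)
  qed
  have K0: "0 \<le> K" using K2[of 0] n norm_ge_zero order_trans
    by (metis Suc_1 Suc_le_lessD numeral_3_eq_3)
  define r where "r = map (\<lambda>j. p ! 0 + real j *\<^sub>R (p ! Suc 0 - p ! 0)) [0..<N]"
  have "norm (p ! j - (a + real j *\<^sub>R v)) \<le> real N ^ 3 * K" if j: "j < N" for j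
  proof -
    have "norm (p ! j - (a + real j *\<^sub>R v)) ^ 2 = norm (p ! j - linear_proj p ! j) ^ 2"
      using j by (simp add: q)
    also have "\<dots> \<le> (\<Sum>i<length p. norm (p ! i - linear_proj p ! i) ^ 2)"
      using j N_def by (intro member_le_sum[of j "{..<length p}" "\<lambda>i. norm (p ! i - linear_proj p ! i) ^ 2"]) auto
    also have "\<dots> \<le> (\<Sum>i<length p. norm (p ! i - r ! i) ^ 2)"
      using n unfolding r_def N_def by (intro linear_proj_least_squares linear_chainsI) auto
    also have "\<dots> \<le> (\<Sum>i<length p. (real N ^ 2 * K) ^ 2)"
    proof (intro sum_mono power_mono)
      fix i assume i: "i \<in> {..<length p}"
      have "norm (p ! i - r ! i) \<le> real i ^ 2 * K"
        using near_linear_if_fdiff2_bounded[OF K2 K0, of i] i by (simp add: r_def N_def)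
      also have "\<dots> \<le> real N ^ 2 * K"
        using i K0 by (intro mult_right_mono power_mono) (auto simp: N_def)
      finally show "norm (p ! i - r ! i) \<le> real N ^ 2 * K" .
    qed auto
    also have "\<dots> = real N * (real N ^ 2 * K) ^ 2" by (simp add: N_def)
    \<comment> \<open>The factor \<open>N\<close> is enlarged to \<open>N ^ 2\<close>, which makes
      the right-hand side a perfect square.\<close>
    also have "\<dots> \<le> real N ^ 2 * (real N ^ 2 * K) ^ 2"
      using n by (intro mult_right_mono self_le_power) (auto simp: N_def)
    also have "\<dots> = (real N ^ 3 * K) ^ 2" by (simp add: power_mult_distrib flip: power_mult power_add)
    finally show ?thesis by (rule power2_le_imp_le) (simp add: K0)
  qed
  with v show thesis using that unfolding N_def K_def by (metis mult.assoc)
qed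

section \<open>One step near a linear chain\<close>

text \<open>An orthogonal matrix turns the first axis into the direction of \<open>v\<close>, and
  scaling by \<open>norm v\<close> does the rest. The free translation \<open>s\<close> serves to
  match base points.\<close>

lemma similarity_mapping_unit:
  fixes s v :: "real ^ 'd::{finite,linorder}"
  assumes "v \<noteq> 0"
  obtains R where "similarity (\<lambda>p. R p + s)" "linear R" "surj R"
    "\<And>x. norm (R x) = norm v * norm x" "R first_unit = v"
proof -
  define u where "u = v /\<^sub>R norm v"
  have "norm u = 1" using assms by (simp add: u_def)
  then obtain A where A: "orthogonal_matrix A" "A *v (axis (Min UNIV) 1) = u"
    using orthogonal_matrix_exists_basis by metis
  have oT: "orthogonal_transformation ((*v) A)"
    using A(1) by (simp add: orthogonal_transformation_matrix)
  \<comment> \<open>Similarities multiply row vectors by a matrix from the right, hence the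
    transpose.\<close>
  define R where "R p = norm v *\<^sub>R (p v* transpose A)" for p
  have R: "R p = norm v *\<^sub>R (A *v p)" for p by (simp add: R_def)
  show thesis
  proof (rule that[of R])
    show "similarity (\<lambda>p. R p + s)"
      unfolding similarity_def R_def using assms A(1)
      by (intro exI[of _ "norm v"] exI[of _ "transpose A"] exI[of _ s])
        (simp add: orthogonal_matrix_def)
    show "linear R"
      unfolding R using oT by (intro linear_compose_scale_right orthogonal_transformation_linear)
    show "norm (R x) = norm v * norm x" for x
      using oT by (simp add: R orthogonal_transformation_norm)
    show "R first_unit = v"
      using A(2) assms by (simp add: R first_unit_def u_def)
    show "surj R"
    proof (rule surjI)
      fix y
      have "surj ((*v) A)" using oT by (rule orthogonal_transformation_surj)
      then have "A *v (inv ((*v) A) (y /\<^sub>R norm v)) = y /\<^sub>R norm v" by (rule surj_f_inv_f)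
      then show "R (inv ((*v) A) (y /\<^sub>R norm v)) = y" using assms by (simp add: R)
    qed
  qed
qed

lemma length_unit_chain [simp]: "length (unit_chain N) = N"
  by (simp add: unit_chain_def)

lemma unit_chain_nth: "j < N \<Longrightarrow> unit_chain N ! j = (1 + real j) *\<^sub>R first_unit"
  by (simp add: unit_chain_def add.commute)

text \<open>Differentiability at \<open>c\<close> with tolerance \<open>1\<close> gives a Lipschitz
  bound based at \<open>c\<close>: the linear part contributes the sum of the block norms, the
  remainder contributes the \<open>1\<close> in \<open>L\<close>.\<close>

lemma lipschitz_at_if_C1_hoelder_near:
  fixes g :: "'a::real_normed_vector list \<Rightarrow> 'b::real_normed_vector"
  assumes "C1_hoelder_near \<nu> g c" and c: "0 < length c"
  obtains L r where "0 \<le> L" "0 < r"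
    "\<And>q. length q = length c \<Longrightarrow> chain_norm 0 (chain_minus q c) < r \<Longrightarrow>
       norm (g q - g c) \<le> L * chain_norm 0 (chain_minus q c)"
proof -
  obtain r0 D where r0: "r0 > 0" and
    D: "\<And>p. length p = length c \<Longrightarrow> chain_norm 0 (chain_minus p c) < r0 \<Longrightarrow>
          chain_has_derivative g (D p) p"
    using assms(1) unfolding C1_hoelder_near_def Let_def by blast
  have "chain_norm 0 (chain_minus c c) \<le> 0"
    using c by (intro chain_norm_0_le) (auto simp: chain_minus_nth)
  then have "chain_has_derivative g (D c) c" using D[of c] r0 by linarith
  from this[unfolded chain_has_derivative_def, THEN spec[of _ 1]]
  obtain r where r: "r > 0" and
    deriv: "\<And>q. length q = length c \<Longrightarrow> chain_norm 0 (chain_minus q c) < r \<Longrightarrow>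
       norm (g q - g c - (\<Sum>i<length c. blinfun_apply (D c i) (q ! i - c ! i)))
         \<le> 1 * chain_norm 0 (chain_minus q c)"
    by auto
  define L where "L = 1 + (\<Sum>i<length c. norm (D c i))"
  show thesis
  proof (rule that[of L r])
    show "0 \<le> L" unfolding L_def by (simp add: sum_nonneg)
    show "0 < r" by (rule r)
    fix q assume q: "length q = length c" "chain_norm 0 (chain_minus q c) < r"
    let ?x = "chain_norm 0 (chain_minus q c)" and ?S = "\<Sum>i<length c. blinfun_apply (D c i) (q ! i - c ! i)"
    have "norm ?S \<le> (\<Sum>i<length c. norm (D c i) * ?x)"
    proof (intro sum_norm_le)
      fix i assume i: "i \<in> {..<length c}"
      have "norm (q ! i - c ! i) \<le> ?x"
        using norm_nth_le_chain_norm_0[of i "chain_minus q c"] i q by (simp add: chain_minus_nth)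
      then show "norm (blinfun_apply (D c i) (q ! i - c ! i)) \<le> norm (D c i) * ?x"
        by (intro order_trans[OF norm_blinfun mult_left_mono]) auto
    qed
    then have "norm ?S \<le> (\<Sum>i<length c. norm (D c i)) * ?x" by (simp add: sum_distrib_right)
    moreover have "norm (g q - g c) \<le> norm (g q - g c - ?S) + norm ?S"
      using norm_triangle_sub[of "g q - g c" ?S] by linarith
    ultimately show "norm (g q - g c) \<le> L * ?x"
      using deriv[OF q] by (simp add: L_def algebra_simps)
  qed
qed

text \<open>A chain near the linear chain \<open>a, a + v, \<dots>\<close> is the similarity image of a chain near the
  unit chain, and the similarity scales all errors by \<open>norm v\<close>.\<close>

lemma equivariant_rule_near_linear:
  fixes g :: "(real ^ 'd::{finite,linorder}) list \<Rightarrow> real ^ 'd::{finite,linorder}"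
  assumes equivariant: "\<And>S q. similarity S \<Longrightarrow> length q = Suc m \<Longrightarrow> g (map S q) = S (g q)"
    and C1: "C1_hoelder_near \<nu> g (unit_chain (Suc m))"
    and val: "g (unit_chain (Suc m)) = (1 + c) *\<^sub>R first_unit"
  obtains L r where "0 \<le> L" "0 < r"
    "\<And>q a v \<delta>. length q = Suc m \<Longrightarrow> v \<noteq> 0 \<Longrightarrow> \<delta> < r \<Longrightarrow>
       (\<And>j. j \<le> m \<Longrightarrow> norm (q ! j - (a + real j *\<^sub>R v)) \<le> \<delta> * norm v) \<Longrightarrow>
       norm (g q - (a + c *\<^sub>R v)) \<le> L * \<delta> * norm v"
proof -
  let ?E = "unit_chain (Suc m) :: (real ^ 'd::{finite,linorder}) list"
  have "0 < length ?E" by simp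
  obtain L r where L: "0 \<le> L" and r: "0 < r" and
    lip: "\<And>q. length q = length ?E \<Longrightarrow> chain_norm 0 (chain_minus q ?E) < r \<Longrightarrow>
       norm (g q - g ?E) \<le> L * chain_norm 0 (chain_minus q ?E)"
    by (rule lipschitz_at_if_C1_hoelder_near[OF C1 \<open>0 < length ?E\<close>]) blast
  show thesis
  proof (rule that[OF L r])
    fix q :: "(real ^ 'd::{finite,linorder}) list" and a v :: "real ^ 'd::{finite,linorder}" and \<delta>
    assume q: "length q = Suc m" and v: "v \<noteq> 0" and \<delta>: "\<delta> < r"
      and near: "\<And>j. j \<le> m \<Longrightarrow> norm (q ! j - (a + real j *\<^sub>R v)) \<le> \<delta> * norm v"
    \<comment> \<open>The unit chain starts at \<open>first_unit\<close> and not at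
      \<open>0\<close>, so its point \<open>j\<close> is sent to
      \<open>(1 + j) v + s = a + j v\<close>.\<close>
    define s where "s = a - v"
    obtain R where S: "similarity (\<lambda>p. R p + s)" and R: "linear R" "surj R"
      "\<And>x. norm (R x) = norm v * norm x" "R first_unit = v"
      using similarity_mapping_unit[OF v, of s] by blast
    \<comment> \<open>The deviation from the linear chain, pulled back to the scale of the unit
      chain. As \<open>R\<close> multiplies norms by \<open>norm v\<close>, its size is at most
      \<open>\<delta>\<close>.\<close>
    define d where "d j = inv R (q ! j - (a + real j *\<^sub>R v))" for j
    have Rd: "R (d j) = q ! j - (a + real j *\<^sub>R v)" for j
      unfolding d_def by (rule surj_f_inv_f[OF R(2)])
    have d: "norm (d j) \<le> \<delta>" if "j \<le> m" for j
      using near[OF that] v unfolding Rd[symmetric] R(3) by (simp add: mult.commute)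
    define q' where "q' = map (\<lambda>j. ?E ! j + d j) [0..<Suc m]"
    have q'n: "q' ! j = (1 + real j) *\<^sub>R first_unit + d j" if "j \<le> m" for j
      using that by (simp add: q'_def unit_chain_nth del: upt_Suc)
    have "map (\<lambda>p. R p + s) q' ! j = q ! j" if "j \<le> m" for j
      using that by (simp add: q'_def unit_chain_nth linear_add[OF R(1)] linear_scale[OF R(1)]
          R(4) Rd s_def algebra_simps del: upt_Suc)
    then have qq': "map (\<lambda>p. R p + s) q' = q"
      using q by (intro nth_equalityI) (auto simp: q'_def)
    have len: "length q' = Suc m" by (simp add: q'_def)
    have cn: "chain_norm 0 (chain_minus q' ?E) \<le> \<delta>"
      using len d by (intro chain_norm_0_le) (auto simp: chain_minus_nth q'n unit_chain_nth)
    have "g q - (a + c *\<^sub>R v) = R (g q') + s - (a + c *\<^sub>R v)"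
      using equivariant[OF S len] by (simp add: qq')
    also have "\<dots> = R (g q' - g ?E)"
      by (simp add: val s_def linear_diff[OF R(1)] linear_add[OF R(1)] linear_scale[OF R(1)] R(4) algebra_simps)
    finally have "norm (g q - (a + c *\<^sub>R v)) = norm v * norm (g q' - g ?E)" by (simp add: R(3))
    also have "\<dots> \<le> norm v * (L * \<delta>)"
      using lip[of q'] cn \<delta> len L by (intro mult_left_mono) (auto intro: order_trans mult_left_mono)
    finally show "norm (g q - (a + c *\<^sub>R v)) \<le> L * \<delta> * norm v" by (simp add: mult_ac)
  qed
qed

section \<open>Windows of a long chain\<close>

lemma subchain_nth: "j < k \<Longrightarrow> i + k \<le> length P \<Longrightarrow> subchain k i P ! j = P ! (i + j)"
  by (simp add: subchain_def)

lemma length_subchain: "i + k \<le> length P \<Longrightarrow> length (subchain k i P) = k"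
  by (simp add: subchain_def)

lemma rel_distortion_le_distortion:
  assumes "i + n \<le> length P"
  shows "rel_distortion (subchain n i P) \<le> distortion n P"
proof -
  have "subchains n P \<subseteq> (\<lambda>i. subchain n i P) ` {..length P}"
    by (auto simp: subchains_def)
  then have "finite (subchains n P)" by (rule finite_subset) simp
  then show ?thesis
    using assms unfolding distortion_def by (intro Max_ge) (auto simp: subchains_def)
qed

text \<open>Near the right end fewer than \<open>n\<close> points may follow index \<open>i\<close>.
  The full window then starts further left, at \<open>b\<close>, still contains the points
  \<open>i\<close> to \<open>i + s\<close>, and its base point is moved by \<open>i - b\<close>
  steps.\<close>

lemma near_linear_if_distortion:
  fixes P :: "'a::real_inner list"
  assumes n: "3 \<le> n" "n \<le> length P" and k: "distortion n P \<le> ereal k"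
    and s: "s < n" "i + s < length P"
  obtains a v where "v \<noteq> 0"
    "\<And>j. j \<le> s \<Longrightarrow> norm (P ! (i + j) - (a + real j *\<^sub>R v)) \<le> real n ^ 3 * k * norm v"
proof -
  define b where "b = min i (length P - n)"
  have b: "b + n \<le> length P" "b \<le> i" "i - b + s < n"
    using n s by (auto simp: b_def)
  let ?p = "subchain n b P"
  have len: "length ?p = n" using b by (simp add: length_subchain)
  obtain a v where v: "v \<noteq> 0" and
    near: "\<And>j. j < n \<Longrightarrow> norm (?p ! j - (a + real j *\<^sub>R v)) \<le> real n ^ 3 * k * norm v"
    by (rule near_linear_if_rel_distortion[of ?p k, unfolded len,
          OF n(1) order_trans[OF rel_distortion_le_distortion[OF b(1)] k]]) (rule that)
  show thesis
  proof (rule that[OF v])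
    fix j assume j: "j \<le> s"
    have "i - b + j < n" using j b by simp
    then have "norm (P ! (b + (i - b + j)) - (a + real (i - b + j) *\<^sub>R v)) \<le> real n ^ 3 * k * norm v"
      using near[of "i - b + j"] b by (simp add: subchain_nth)
    then show "norm (P ! (i + j) - ((a + real (i - b) *\<^sub>R v) + real j *\<^sub>R v)) \<le> real n ^ 3 * k * norm v"
      using b(2) by (simp only: of_nat_add scaleR_left_distrib add.assoc[symmetric] le_add_diff_inverse)
  qed
qed

lemma norm_diff_diff_le:
  fixes x y z :: "'a::real_normed_vector"
  assumes "w = x - y - z" "norm x \<le> a" "norm y \<le> b" "norm z \<le> c"
  shows "norm w \<le> a + b + c"
  using assms norm_triangle_ineq4[of "x - y" z] norm_triangle_ineq4[of x y] by simp

section \<open>Error estimates for one refinement step\<close>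

text \<open>\<open>c = (m + \<tau> - 1) / 2\<close> for a scheme with shift \<open>\<tau>\<close>; \<open>g_near\<close> is all that is used of the
  smoothness of the rules.\<close>

locale glue =
  fixes n m :: nat and G :: "(real ^ 'd::{finite,linorder}) list \<Rightarrow> (real ^ 'd::{finite,linorder}) list"
    and c L r :: real and g :: "nat \<Rightarrow> (real ^ 'd::{finite,linorder}) list \<Rightarrow> real ^ 'd::{finite,linorder}"
  assumes m: "1 \<le> m" and n: "n = 2 * m + 1" and L: "0 \<le> L" and r: "0 < r" "r \<le> 1 / 4"
    and length_G: "n \<le> length P \<Longrightarrow> length (G P) = 2 * length P - n + 1"
    and G_nth: "n \<le> length P \<Longrightarrow> i < length P - m \<Longrightarrow> \<mu> < 2 \<Longrightarrow>
          G P ! (2 * i + \<mu>) = g \<mu> (subchain (Suc m) i P)"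
    and g_near: "\<mu> < 2 \<Longrightarrow> length q = Suc m \<Longrightarrow> v \<noteq> 0 \<Longrightarrow> \<delta> < r \<Longrightarrow>
       (\<And>j. j \<le> m \<Longrightarrow> norm (q ! j - (a + real j *\<^sub>R v)) \<le> \<delta> * norm v) \<Longrightarrow>
       norm (g \<mu> q - (a + (c + real \<mu> / 2) *\<^sub>R v)) \<le> L * \<delta> * norm v"
begin

lemma G_nth_near:
  assumes P: "n \<le> length P" and i: "i < length P - m" and "\<mu> < 2" "v \<noteq> 0" "\<delta> < r"
    and "\<And>j. j \<le> m \<Longrightarrow> norm (P ! (i + j) - (a + real j *\<^sub>R v)) \<le> \<delta> * norm v"
  shows "norm (G P ! (2 * i + \<mu>) - (a + (c + real \<mu> / 2) *\<^sub>R v)) \<le> L * \<delta> * norm v"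
  unfolding G_nth[OF P i \<open>\<mu> < 2\<close>] using assms by (intro g_near) (auto simp: subchain_def)

text \<open>Makes the auxiliary step \<open>v\<close> comparable with the actual difference at
  \<open>i\<close>, so that the later estimates can be stated in terms of the chain alone.\<close>

lemma window:
  assumes P: "n \<le> length P" and k: "distortion n P \<le> ereal k" "real n ^ 3 * k < r"
    and s: "1 \<le> s" "s < n" "i + s < length P"
  obtains a v where "v \<noteq> 0"
    "\<And>j. j \<le> s \<Longrightarrow> norm (P ! (i + j) - (a + real j *\<^sub>R v)) \<le> (real n ^ 3 * k) * norm v"
    "norm ((P ! Suc i - P ! i) - v) \<le> 2 * (real n ^ 3 * k) * norm v"
    "norm v \<le> 2 * norm (P ! Suc i - P ! i)"
    "0 \<le> real n ^ 3 * k"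
proof -
  define \<delta> where "\<delta> = real n ^ 3 * k"
  have "3 \<le> n" using n m by simp
  obtain a v where v: "v \<noteq> 0" and
    near: "\<And>j. j \<le> s \<Longrightarrow> norm (P ! (i + j) - (a + real j *\<^sub>R v)) \<le> \<delta> * norm v"
    by (rule near_linear_if_distortion[OF \<open>3 \<le> n\<close> P k(1) s(2,3), folded \<delta>_def]) (rule that)
  have "norm (P ! i - a) \<le> \<delta> * norm v" "norm (P ! Suc i - (a + v)) \<le> \<delta> * norm v"
    using near[of 0] near[of 1] s by auto
  moreover have "norm (P ! Suc i - P ! i - v) \<le> norm (P ! Suc i - (a + v)) + norm (P ! i - a)"
    using norm_triangle_ineq4[of "P ! Suc i - (a + v)" "P ! i - a"] by (simp add: algebra_simps)
  ultimately have diff: "norm ((P ! Suc i - P ! i) - v) \<le> 2 * \<delta> * norm v" by linarith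
  have "0 \<le> \<delta> * norm v" using near[of 0] norm_ge_zero order_trans by blast
  then have \<delta>: "0 \<le> \<delta>" using v by (simp add: zero_le_mult_iff)
  \<comment> \<open>The cap \<open>r \<le> 1 / 4\<close> is chosen for this: the difference at
    \<open>i\<close> deviates from \<open>v\<close> by at most half of
    \<open>norm v\<close>.\<close>
  have "2 * \<delta> * norm v \<le> (1/2) * norm v"
    using k(2) r \<delta>_def by (intro mult_right_mono) auto
  with diff have "norm v \<le> 2 * norm (P ! Suc i - P ! i)"
    using norm_triangle_sub[of v "P ! Suc i - P ! i"] by (simp add: norm_minus_commute)
  then show thesis using that v near diff \<delta> unfolding \<delta>_def by blast
qed

text \<open>Both new points are predicted from the same linear chain, and the predictions differ by
  exactly \<open>v / 2\<close>. Two rule errors and half the error of the old difference add up to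
  at most \<open>2 * (L + 1) * \<delta> * norm v\<close>; replacing \<open>norm v\<close> by the old
  difference doubles the constant.\<close>

lemma diff_refine:
  assumes P: "n \<le> length P" and k: "distortion n P \<le> ereal k" "real n ^ 3 * k < r"
    and i: "Suc i < length (G P)"
  shows "norm ((G P ! Suc i - G P ! i) - (1 / 2) *\<^sub>R (P ! Suc (i div 2) - P ! (i div 2)))
    \<le> 4 * (L + 1) * real n ^ 3 * k * norm (P ! Suc (i div 2) - P ! (i div 2))"
proof -
  define i0 where "i0 = i div 2"
  define \<delta> where "\<delta> = real n ^ 3 * k"
  have lenG: "length (G P) = 2 * length P - 2 * m" using length_G[OF P] n P by simp
  \<comment> \<open>For odd \<open>i\<close> the two new points come from the rules at
    \<open>i0\<close> and \<open>Suc i0\<close>, so one more old point must be covered.\<close>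
  define s where "s = m + i mod 2"
  have s: "1 \<le> s" "s < n" "i0 + s < length P"
    using m n i P unfolding s_def i0_def lenG by presburger+
  obtain a v where v: "v \<noteq> 0" and
    near: "\<And>j. j \<le> s \<Longrightarrow> norm (P ! (i0 + j) - (a + real j *\<^sub>R v)) \<le> \<delta> * norm v" and
    D: "norm ((P ! Suc i0 - P ! i0) - v) \<le> 2 * \<delta> * norm v" and
    vle: "norm v \<le> 2 * norm (P ! Suc i0 - P ! i0)" and \<delta>: "0 \<le> \<delta>"
    by (rule window[OF P k s, folded \<delta>_def]) (rule that)
  have \<delta>r: "\<delta> < r" using k by (simp add: \<delta>_def)
  define u where "u = (if even i then a + c *\<^sub>R v else a + (c + 1 / 2) *\<^sub>R v)"
  have "norm (G P ! i - u) \<le> L * \<delta> * norm v \<and> norm (G P ! Suc i - (u + (1 / 2) *\<^sub>R v)) \<le> L * \<delta> * norm v"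
  proof (cases "even i")
    case True
    then have i: "i = 2 * i0" "i0 < length P - m" using s by (auto simp: i0_def s_def)
    show ?thesis
      using G_nth_near[OF P i(2) _ v \<delta>r near, of 0] G_nth_near[OF P i(2) _ v \<delta>r near, of 1] True
      by (simp add: i(1) u_def s_def algebra_simps)
  next
    case False
    then have i: "i = 2 * i0 + 1" "i0 < length P - m" "Suc i0 < length P - m"
      using s by (auto simp: i0_def s_def odd_iff_mod_2_eq_one)
    \<comment> \<open>The rule at \<open>Suc i0\<close> sees the same linear chain with base point
      \<open>a + v\<close>; its prediction for \<open>\<mu> = 0\<close> is the prediction
      \<open>u\<close> for point \<open>i\<close> plus \<open>v / 2\<close>.\<close>
    have near': "norm (P ! (Suc i0 + j) - ((a + v) + real j *\<^sub>R v)) \<le> \<delta> * norm v" if "j \<le> m" for j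
      using near[of "Suc j"] that False by (simp add: s_def odd_iff_mod_2_eq_one algebra_simps)
    have u: "u = a + (c + 1 / 2) *\<^sub>R v" using False by (simp add: u_def)
    have "(c + 1 / 2) *\<^sub>R v + (1 / 2) *\<^sub>R v = (1 + c) *\<^sub>R v"
      by (simp flip: scaleR_add_left)
    then have u': "u + (1 / 2) *\<^sub>R v = a + v + c *\<^sub>R v"
      by (simp add: u add.assoc scaleR_left_distrib)
    have "norm (G P ! i - u) \<le> L * \<delta> * norm v"
      using G_nth_near[OF P i(2) _ v \<delta>r near, of 1] False by (simp add: i(1) u s_def)
    moreover have "norm (G P ! Suc i - (u + (1 / 2) *\<^sub>R v)) \<le> L * \<delta> * norm v"
      unfolding u' using G_nth_near[OF P i(3) _ v \<delta>r near', of 0] by (simp add: i(1))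
    ultimately show ?thesis ..
  qed
  moreover have "(G P ! Suc i - G P ! i) - (1 / 2) *\<^sub>R (P ! Suc i0 - P ! i0)
      = (G P ! Suc i - (u + (1 / 2) *\<^sub>R v)) - (G P ! i - u) - (1 / 2) *\<^sub>R ((P ! Suc i0 - P ! i0) - v)"
    by (simp add: algebra_simps)
  moreover have "norm ((1 / 2) *\<^sub>R ((P ! Suc i0 - P ! i0) - v)) \<le> \<delta> * norm v" using D by simp
  ultimately have "norm ((G P ! Suc i - G P ! i) - (1 / 2) *\<^sub>R (P ! Suc i0 - P ! i0))
      \<le> L * \<delta> * norm v + L * \<delta> * norm v + \<delta> * norm v"
    by (elim conjE) (rule norm_diff_diff_le)
  also have "\<dots> \<le> (2 * (L + 1) * \<delta>) * norm v" using \<delta> by (simp add: algebra_simps)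
  also have "\<dots> \<le> (2 * (L + 1) * \<delta>) * (2 * norm (P ! Suc i0 - P ! i0))"
    using vle \<delta> L by (intro mult_left_mono) auto
  finally show ?thesis by (simp add: i0_def \<delta>_def algebra_simps)
qed

text \<open>The second difference vanishes on the linear chain, so only point errors survive, the
  middle one twice: four times \<open>\<delta> * norm v\<close>.\<close>

lemma diff_neighbour:
  assumes P: "n \<le> length P" and k: "distortion n P \<le> ereal k" "real n ^ 3 * k < r"
    and i: "Suc (Suc i) < length P"
  shows "norm ((P ! Suc (Suc i) - P ! Suc i) - (P ! Suc i - P ! i))
    \<le> 4 * 2 * real n ^ 3 * k * norm (P ! Suc i - P ! i)"
proof -
  define \<delta> where "\<delta> = real n ^ 3 * k"
  have s: "1 \<le> (2::nat)" "2 < n" "i + 2 < length P" using m n i by auto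
  obtain a v where near: "\<And>j. j \<le> 2 \<Longrightarrow> norm (P ! (i + j) - (a + real j *\<^sub>R v)) \<le> \<delta> * norm v" and
    vle: "norm v \<le> 2 * norm (P ! Suc i - P ! i)" and \<delta>: "0 \<le> \<delta>"
    by (rule window[OF P k s, folded \<delta>_def]) (rule that)
  have near3: "norm (P ! i - a) \<le> \<delta> * norm v" "norm (P ! Suc i - (a + v)) \<le> \<delta> * norm v"
    "norm (P ! Suc (Suc i) - (a + 2 *\<^sub>R v)) \<le> \<delta> * norm v"
    using near[of 0] near[of 1] near[of 2] by auto
  have "(P ! Suc (Suc i) - P ! Suc i) - (P ! Suc i - P ! i)
      = (P ! Suc (Suc i) - (a + 2 *\<^sub>R v)) - (P ! Suc i - (a + v)) - ((P ! Suc i - (a + v)) - (P ! i - a))"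
    by (simp add: scaleR_2)
  moreover have "norm ((P ! Suc i - (a + v)) - (P ! i - a)) \<le> 2 * \<delta> * norm v"
    using near3 norm_triangle_ineq4[of "P ! Suc i - (a + v)" "P ! i - a"] by linarith
  ultimately have "norm ((P ! Suc (Suc i) - P ! Suc i) - (P ! Suc i - P ! i))
      \<le> \<delta> * norm v + \<delta> * norm v + 2 * \<delta> * norm v"
    by (intro norm_diff_diff_le[OF _ near3(3,2)])
  also have "\<dots> = 4 * \<delta> * norm v" by simp
  also have "\<dots> \<le> 4 * \<delta> * (2 * norm (P ! Suc i - P ! i))"
    using vle \<delta> by (intro mult_left_mono) auto
  finally show ?thesis by (simp add: \<delta>_def mult_ac)
qed

text \<open>The new point is offset from the old one by a fixed multiple of \<open>v\<close>, so the
  bound is proportional to the old difference but does not become small with \<open>k\<close>. This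
  suffices once the differences themselves decay geometrically.\<close>

lemma point_refine:
  assumes P: "n \<le> length P" and k: "distortion n P \<le> ereal k" "real n ^ 3 * k < r"
    and i: "i < length (G P)"
  shows "norm (G P ! i - P ! (i div 2)) \<le> 2 * (L + 2 + \<bar>c\<bar>) * norm (P ! Suc (i div 2) - P ! (i div 2))"
proof -
  define i0 where "i0 = i div 2"
  define \<delta> where "\<delta> = real n ^ 3 * k"
  have lenG: "length (G P) = 2 * length P - 2 * m" using length_G[OF P] n P by simp
  have s: "1 \<le> m" "m < n" "i0 + m < length P"
    using m n i P unfolding i0_def lenG by presburger+
  obtain a v where v: "v \<noteq> 0" and
    near: "\<And>j. j \<le> m \<Longrightarrow> norm (P ! (i0 + j) - (a + real j *\<^sub>R v)) \<le> \<delta> * norm v" and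
    vle: "norm v \<le> 2 * norm (P ! Suc i0 - P ! i0)" and \<delta>: "0 \<le> \<delta>"
    by (rule window[OF P k s, folded \<delta>_def]) (rule that)
  have \<delta>r: "\<delta> < r" using k by (simp add: \<delta>_def)
  let ?c = "c + real (i mod 2) / 2"
  have "2 * i0 + i mod 2 = i" by (simp add: i0_def)
  then have 1: "norm (G P ! i - (a + ?c *\<^sub>R v)) \<le> L * \<delta> * norm v"
    using G_nth_near[OF P _ _ v \<delta>r near, of "i mod 2"] s by simp
  have 2: "norm (P ! i0 - a) \<le> \<delta> * norm v" using near[of 0] by simp
  have "G P ! i - P ! i0 = (G P ! i - (a + ?c *\<^sub>R v)) - (P ! i0 - a) - (- ?c) *\<^sub>R v" 
    by (simp only: scaleR_minus_left diff_minus_eq_add) simp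
  moreover have "norm ((- ?c) *\<^sub>R v) \<le> \<bar>?c\<bar> * norm v" 
    by (simp only: norm_scaleR abs_minus_cancel order_refl)
  ultimately have "norm (G P ! i - P ! i0) \<le> L * \<delta> * norm v + \<delta> * norm v + \<bar>?c\<bar> * norm v"
    by (intro norm_diff_diff_le[OF _ 1 2])
  also have "\<dots> = (L * \<delta> + \<delta> + \<bar>?c\<bar>) * norm v" by (simp add: algebra_simps)
  also have "\<dots> \<le> (L + 2 + \<bar>c\<bar>) * norm v"
  proof (intro mult_right_mono)
    have "\<delta> \<le> 1" using \<delta>r r by simp
    then have "L * \<delta> \<le> L" using L by (simp add: mult_left_le)
    moreover have "real (i mod 2) / 2 \<le> 1" by (simp add: field_simps)
    \<comment> \<open>The \<open>2\<close> absorbs \<open>\<delta> \<le> 1\<close> and the half step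
      of an odd index.\<close>
    ultimately show "L * \<delta> + \<delta> + \<bar>?c\<bar> \<le> L + 2 + \<bar>c\<bar>" using \<open>\<delta> \<le> 1\<close> \<delta>r r by linarith
  qed simp
  also have "\<dots> \<le> (L + 2 + \<bar>c\<bar>) * (2 * norm (P ! Suc i0 - P ! i0))"
    using vle L by (intro mult_left_mono) auto
  finally show ?thesis by (simp add: i0_def algebra_simps)
qed

end

section \<open>Uniform limits of dyadic step functions\<close>

definition dyadic_floor :: "nat \<Rightarrow> real \<Rightarrow> nat" where
  "dyadic_floor l t = nat \<lfloor>2 ^ l * t\<rfloor>"

text \<open>The parent of a dyadic interval has half its index. This is the same
  \<open>i div 2\<close> that links a refined chain to the previous one.\<close>

lemma dyadic_floor_Suc_div_2: "dyadic_floor (Suc l) t div 2 = dyadic_floor l t"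
proof -
  have "\<lfloor>2 ^ l * t\<rfloor> = \<lfloor>(2 ^ Suc l * t) / real_of_int 2\<rfloor>" by simp
  also have "\<dots> = \<lfloor>2 ^ Suc l * t\<rfloor> div 2" by (rule floor_divide_real_eq_div) simp
  finally show ?thesis by (simp add: dyadic_floor_def nat_div_distrib')
qed

lemma dyadic_floor_le: "0 \<le> t \<Longrightarrow> real (dyadic_floor l t) \<le> 2 ^ l * t"
  by (simp add: dyadic_floor_def)

lemma less_dyadic_floor: "2 ^ l * t < real (dyadic_floor l t) + 1"
  unfolding dyadic_floor_def by linarith

lemma dyadic_floor_le_bound: "0 \<le> t \<Longrightarrow> t \<le> real w \<Longrightarrow> dyadic_floor l t \<le> 2 ^ l * w"
proof -
  assume t: "0 \<le> t" "t \<le> real w"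
  have "real (dyadic_floor l t) \<le> 2 ^ l * t" using t by (intro dyadic_floor_le)
  also have "\<dots> \<le> 2 ^ l * real w" using t by simp
  finally have "real (dyadic_floor l t) \<le> real (2 ^ l * w)" by simp
  then show ?thesis by (simp only: of_nat_le_iff)
qed

lemma dyadic_floor_dyadic: "dyadic_floor l (real i / 2 ^ l) = i"
  by (simp add: dyadic_floor_def)

lemma dyadic_floor_mono: "s \<le> t \<Longrightarrow> dyadic_floor l s \<le> dyadic_floor l t"
  by (simp add: dyadic_floor_def floor_mono nat_mono)

lemma dyadic_floor_le_Suc: "t \<le> s + 1 / 2 ^ l \<Longrightarrow> dyadic_floor l t \<le> Suc (dyadic_floor l s)"
proof -
  assume "t \<le> s + 1 / 2 ^ l"
  then have "2 ^ l * t \<le> 2 ^ l * s + 1" by (simp add: field_simps)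
  then have "\<lfloor>2 ^ l * t\<rfloor> \<le> \<lfloor>2 ^ l * s\<rfloor> + 1" by linarith
  then show ?thesis by (simp add: dyadic_floor_def)
qed

lemma tendsto_half_power: "(\<lambda>l. 1 / 2 ^ l :: real) \<longlonglongrightarrow> 0"
  using LIMSEQ_power_zero[of "1 / 2 :: real"] by (simp add: power_one_over)

lemma dyadic_floor_tendsto:
  assumes "0 \<le> t"
  shows "(\<lambda>l. real (dyadic_floor l t) / 2 ^ l) \<longlonglongrightarrow> t"
proof (rule tendsto_sandwich)
  show "(\<lambda>l. t - 1 / 2 ^ l) \<longlonglongrightarrow> t"
    using tendsto_diff[OF tendsto_const tendsto_half_power, of t] by simp
  show "\<forall>\<^sub>F l in sequentially. t - 1 / 2 ^ l \<le> real (dyadic_floor l t) / 2 ^ l"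
  proof (intro always_eventually allI)
    fix l
    have "t \<le> (real (dyadic_floor l t) + 1) / 2 ^ l"
      using less_dyadic_floor[of l t] by (simp add: pos_le_divide_eq mult.commute less_imp_le)
    then show "t - 1 / 2 ^ l \<le> real (dyadic_floor l t) / 2 ^ l" by (simp add: add_divide_distrib)
  qed
  show "\<forall>\<^sub>F l in sequentially. real (dyadic_floor l t) / 2 ^ l \<le> t"
    using dyadic_floor_le[OF assms] by (intro always_eventually) (simp add: field_simps)
qed simp

text \<open>\<open>y l k\<close> is the value of a step function on the \<open>k\<close>-th dyadic interval of length \<open>2^-l\<close>.\<close>

locale step_refinement =
  fixes y :: "nat \<Rightarrow> nat \<Rightarrow> 'a::banach" and w L :: nat and T \<eta> :: "nat \<Rightarrow> real"
  assumes refine: "\<And>l k. L \<le> l \<Longrightarrow> k \<le> 2 ^ Suc l * w \<Longrightarrow>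
      norm (y (Suc l) k - y l (k div 2)) \<le> T l - T (Suc l)"
    and neighbour: "\<And>l k. L \<le> l \<Longrightarrow> Suc k \<le> 2 ^ l * w \<Longrightarrow> norm (y l (Suc k) - y l k) \<le> \<eta> l"
    and T: "T \<longlonglongrightarrow> 0" and \<eta>: "\<eta> \<longlonglongrightarrow> 0" and w: "1 \<le> w"
begin

definition step :: "nat \<Rightarrow> real \<Rightarrow> 'a" where
  "step l t = y l (dyadic_floor l t)"

text \<open>The parameter is clamped to \<open>[0, w]\<close>, so that the limit is continuous on the whole line.\<close>

definition limit :: "real \<Rightarrow> 'a" where
  "limit t = lim (\<lambda>l. step l (max 0 (min t (real w))))"

text \<open>Since each refinement is bounded by a decrement of \<open>T\<close>, the bounds
  collapse, and \<open>T l\<close> alone controls all changes after level \<open>l\<close>.\<close>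

lemma step_telescope:
  assumes t: "0 \<le> t" "t \<le> real w" and "L \<le> l"
  shows "norm (step (l + j) t - step l t) \<le> T l - T (l + j)"
proof (induction j)
  case (Suc j)
  have "norm (step (Suc (l + j)) t - step (l + j) t) \<le> T (l + j) - T (Suc (l + j))"
    using refine[of "l + j" "dyadic_floor (Suc (l + j)) t"] \<open>L \<le> l\<close>
      dyadic_floor_le_bound[OF t, of "Suc (l + j)"]
    unfolding step_def dyadic_floor_Suc_div_2 by simp
  then show ?case
    using Suc norm_triangle_ineq[of "step (Suc (l + j)) t - step (l + j) t" "step (l + j) t - step l t"]
    by simp
qed simp

text \<open>Monotonicity is read off from the telescoped bound at the parameter \<open>0\<close>,
  because norms are nonnegative; with the limit \<open>0\<close> it makes \<open>T\<close>
  nonnegative.\<close>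

lemma T_antimono: "L \<le> l \<Longrightarrow> T (l + j) \<le> T l"
  using order_trans[OF norm_ge_zero step_telescope[of 0 l j]] by simp

lemma T_nonneg: "L \<le> l \<Longrightarrow> 0 \<le> T l"
  using LIMSEQ_ignore_initial_segment[OF T, of l] T_antimono[of l]
  by (intro LIMSEQ_le_const2) (auto simp: add.commute)

lemma step_dist:
  assumes "0 \<le> t" "t \<le> real w" "L \<le> l"
  shows "norm (step (l + j) t - step l t) \<le> T l"
  using step_telescope[OF assms, of j] T_nonneg[of "l + j"] assms by linarith

lemma step_tendsto:
  assumes t: "0 \<le> t" "t \<le> real w"
  shows "(\<lambda>l. step l t) \<longlonglongrightarrow> limit t"
proof -
  have "Cauchy (\<lambda>l. step l t)"
  proof (rule metric_CauchyI)
    fix e :: real assume "0 < e"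
    then have "\<forall>\<^sub>F l in sequentially. T l < e / 2 \<and> L \<le> l"
      using T by (intro eventually_conj order_tendstoD eventually_ge_at_top) auto
    then obtain l where l: "T l < e / 2" "L \<le> l" unfolding eventually_sequentially by blast
    have "dist (step i t) (step l t) < e / 2" if "l \<le> i" for i
      using step_dist[OF t l(2), of "i - l"] l that by (simp add: dist_norm)
    then show "\<exists>M. \<forall>i\<ge>M. \<forall>j\<ge>M. dist (step i t) (step j t) < e"
      by (meson dist_triangle_half_l)
  qed
  then have "(\<lambda>l. step l t) \<longlonglongrightarrow> lim (\<lambda>l. step l t)"
    by (simp add: Cauchy_convergent_iff convergent_LIMSEQ_iff)
  then show ?thesis using t by (simp add: limit_def)
qed

lemma limit_step_dist:
  assumes t: "0 \<le> t" "t \<le> real w" and l: "L \<le> l"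
  shows "norm (limit t - step l t) \<le> T l"
proof (rule tendsto_upperbound)
  show "(\<lambda>j. norm (step (l + j) t - step l t)) \<longlonglongrightarrow> norm (limit t - step l t)"
    using LIMSEQ_ignore_initial_segment[OF step_tendsto[OF t], of l]
    by (intro tendsto_intros) (simp add: add.commute)
  show "\<forall>\<^sub>F j in sequentially. norm (step (l + j) t - step l t) \<le> T l"
    using step_dist[OF t l] by simp
qed simp

lemma limit_dyadic_dist:
  assumes "L \<le> l" "i \<le> 2 ^ l * w"
  shows "norm (limit (real i / 2 ^ l) - y l i) \<le> T l"
proof -
  have "real i \<le> 2 ^ l * real w" using assms(2)
    by (metis of_nat_le_iff of_nat_mult of_nat_numeral of_nat_power)
  then show ?thesis
    using limit_step_dist[of "real i / 2 ^ l" l] assms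
    by (simp add: step_def dyadic_floor_dyadic field_simps)
qed

text \<open>Clamping does not increase distances, and clamped parameters at distance at most
  \<open>1 / 2 ^ l\<close> lie in equal or adjacent dyadic intervals. The step values then differ by
  at most \<open>\<eta> l\<close>, and each passage from limit to step function costs
  \<open>T l\<close>. The absolute value covers equal intervals, as no sign of \<open>\<eta>\<close>
  is assumed.\<close>

lemma limit_modulus:
  assumes l: "L \<le> l" and st: "\<bar>s - t\<bar> \<le> 1 / 2 ^ l"
  shows "norm (limit s - limit t) \<le> 2 * T l + \<bar>\<eta> l\<bar>"
  using st
proof (induction s t rule: linorder_wlog)
  case (le s t)
  define s' where "s' = max 0 (min s (real w))"
  define t' where "t' = max 0 (min t (real w))"
  have s': "0 \<le> s'" "s' \<le> real w" and t': "0 \<le> t'" "t' \<le> real w"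
    by (auto simp: s'_def t'_def)
  have lim: "limit s = limit s'" "limit t = limit t'"
    by (simp_all add: limit_def s'_def t'_def)
  have "s' \<le> t'" "t' \<le> s' + 1 / 2 ^ l"
    using le by (auto simp: s'_def t'_def)
  then have "dyadic_floor l t' = dyadic_floor l s' \<or> dyadic_floor l t' = Suc (dyadic_floor l s')"
    using dyadic_floor_mono[of s' t' l] dyadic_floor_le_Suc[of t' s' l] by linarith
  then have "norm (step l t' - step l s') \<le> \<bar>\<eta> l\<bar>"
    using neighbour[OF l, of "dyadic_floor l s'"] dyadic_floor_le_bound[OF t', of l]
    by (auto simp: step_def)
  moreover have "norm (limit s' - step l s') \<le> T l" "norm (limit t' - step l t') \<le> T l"
    using s' t' l by (simp_all add: limit_step_dist)
  moreover have "limit s' - limit t' =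
      (limit s' - step l s') - (limit t' - step l t') - (step l t' - step l s')" by simp
  ultimately have "norm (limit s' - limit t') \<le> T l + T l + \<bar>\<eta> l\<bar>"
    by (smt (verit) norm_triangle_ineq4)
  then show ?case by (simp add: lim)
next
  case (sym s t)
  then show ?case by (simp add: norm_minus_commute abs_minus_commute)
qed

lemma continuous_limit: "continuous_on UNIV limit"
proof -
  have "\<exists>d>0. \<forall>t. dist t s < d \<longrightarrow> dist (limit t) (limit s) < e" if "0 < e" for e s
  proof -
    have "(\<lambda>l. 2 * T l + \<bar>\<eta> l\<bar>) \<longlonglongrightarrow> 2 * 0 + \<bar>0\<bar>"
      using T \<eta> by (intro tendsto_intros)
    then have "\<forall>\<^sub>F l in sequentially. 2 * T l + \<bar>\<eta> l\<bar> < e \<and> L \<le> l"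
      using that by (intro eventually_conj order_tendstoD eventually_ge_at_top) auto
    then obtain l where l: "2 * T l + \<bar>\<eta> l\<bar> < e" "L \<le> l" unfolding eventually_sequentially by blast
    show ?thesis
    proof (intro exI[of _ "1 / 2 ^ l"] conjI allI impI)
      fix t assume "dist t s < 1 / 2 ^ l"
      then show "dist (limit t) (limit s) < e"
        using limit_modulus[OF l(2), of t s] l(1) by (simp add: dist_norm)
    qed simp
  qed
  then show ?thesis by (simp add: continuous_on_iff)
qed

end

section \<open>Differentiability of the limit\<close>

text \<open>If the scaled difference quotients of \<open>x\<close> converge as well, the chains are Riemann sums of
  the limit of the quotients.\<close>

locale differentiable_step_refinement =
  x: step_refinement x w L T \<eta> +
  y: step_refinement "\<lambda>l k. 2 ^ l *\<^sub>R (x l (Suc k) - x l k)" w L' T' \<eta>'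
  for x :: "nat \<Rightarrow> nat \<Rightarrow> 'a::banach" and w L T \<eta> L' T' \<eta>'
begin

text \<open>A mean value estimate: at level \<open>l\<close> the increment of the chain telescopes
  into differences, each within \<open>(e + T' l) / 2 ^ l\<close> of \<open>z / 2 ^ l\<close>. Their
  number times \<open>1 / 2 ^ l\<close> tends to \<open>t - s\<close>.\<close>

lemma limit_diff_near:
  assumes st: "0 \<le> s" "s \<le> t" "t \<le> real w" and "0 < \<delta>"
    and z: "\<And>u. 0 \<le> u \<Longrightarrow> s - \<delta> \<le> u \<Longrightarrow> u \<le> t \<Longrightarrow> norm (y.limit u - z) \<le> e"
  shows "norm (x.limit t - x.limit s - (t - s) *\<^sub>R z) \<le> (t - s) * e"
proof (rule tendsto_le)
  let ?i = "\<lambda>l. dyadic_floor l s" and ?j = "\<lambda>l. dyadic_floor l t"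
  let ?r = "\<lambda>l. real (?j l) / 2 ^ l - real (?i l) / 2 ^ l"
  have r: "?r \<longlonglongrightarrow> t - s" using st by (intro tendsto_diff dyadic_floor_tendsto) auto
  show "(\<lambda>l. norm (x.step l t - x.step l s - ?r l *\<^sub>R z)) \<longlonglongrightarrow>
      norm (x.limit t - x.limit s - (t - s) *\<^sub>R z)"
    using st by (intro tendsto_norm tendsto_diff tendsto_scaleR r tendsto_const x.step_tendsto) auto
  have "(\<lambda>l. ?r l * (e + T' l)) \<longlonglongrightarrow> (t - s) * (e + 0)"
    by (intro tendsto_mult r tendsto_add tendsto_const y.T)
  then show "(\<lambda>l. ?r l * (e + T' l)) \<longlonglongrightarrow> (t - s) * e" by simp
  \<comment> \<open>The dyadic interval containing \<open>s\<close> may begin to the left of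
    \<open>s\<close>, by less than \<open>1 / 2 ^ l\<close>; the margin \<open>\<delta>\<close>
    makes room for it.\<close>
  have "\<forall>\<^sub>F l in sequentially. 1 / 2 ^ l < \<delta> \<and> L' \<le> l"
    using tendsto_half_power \<open>0 < \<delta>\<close>
    by (intro eventually_conj order_tendstoD(2)[of _ 0] eventually_ge_at_top) auto
  then show "\<forall>\<^sub>F l in sequentially. norm (x.step l t - x.step l s - ?r l *\<^sub>R z) \<le> ?r l * (e + T' l)"
  proof eventually_elim
    case (elim l)
    have ij: "?i l \<le> ?j l" using st by (intro dyadic_floor_mono)
    have "x l (?j l) - x l (?i l) = (\<Sum>k = ?i l..<?j l. x l (Suc k) - x l k)"
      using ij by (simp add: sum_Suc_diff')
    then have "x.step l t - x.step l s - ?r l *\<^sub>R z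
        = (\<Sum>k = ?i l..<?j l. (x l (Suc k) - x l k) - (1 / 2 ^ l) *\<^sub>R z)"
      using ij by (simp add: x.step_def sum_subtractf sum_constant_scaleR of_nat_diff diff_divide_distrib)
    also have "norm \<dots> \<le> (\<Sum>k = ?i l..<?j l. (1 / 2 ^ l) * (e + T' l))"
    proof (rule sum_norm_le)
      fix k assume k: "k \<in> {?i l..<?j l}"
      define u where "u = real k / 2 ^ l"
      have "real k \<le> 2 ^ l * t" using k st dyadic_floor_le[of t l] by simp
      moreover have "2 ^ l * s < real k + 1" using k less_dyadic_floor[of l s] by simp
      ultimately have u: "0 \<le> u" "s - \<delta> \<le> u" "u \<le> t"
        using elim by (auto simp: u_def field_simps)
      have "k \<le> 2 ^ l * w" using k dyadic_floor_le_bound[of t w l] st by simp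
      then have "norm (y.limit u - 2 ^ l *\<^sub>R (x l (Suc k) - x l k)) \<le> T' l"
        using y.limit_dyadic_dist[of l k] elim by (simp add: u_def)
      moreover have "norm (y.limit u - z) \<le> e" using u by (intro z)
      ultimately have "norm (2 ^ l *\<^sub>R (x l (Suc k) - x l k) - z) \<le> e + T' l"
        using norm_triangle_ineq4[of "y.limit u - z" "y.limit u - 2 ^ l *\<^sub>R (x l (Suc k) - x l k)"]
        by simp
      moreover have "(x l (Suc k) - x l k) - (1 / 2 ^ l) *\<^sub>R z
          = (1 / 2 ^ l) *\<^sub>R (2 ^ l *\<^sub>R (x l (Suc k) - x l k) - z)"
        by (simp add: scaleR_diff_right)
      ultimately show "norm ((x l (Suc k) - x l k) - (1 / 2 ^ l) *\<^sub>R z) \<le> (1 / 2 ^ l) * (e + T' l)"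
        by (simp add: divide_right_mono)
    qed
    also have "\<dots> = ?r l * (e + T' l)"
      using ij by (simp add: of_nat_diff left_diff_distrib diff_divide_distrib)
    finally show ?case .
  qed
qed simp

lemma limit_has_vector_derivative:
  assumes t: "0 < t" "t < real w"
  shows "(x.limit has_vector_derivative y.limit t) (at t)"
  unfolding has_vector_derivative_def has_derivative_at_alt
proof (intro conjI allI impI bounded_linear_scaleR_left)
  fix e :: real assume "0 < e"
  then obtain d where d: "0 < d" "\<And>u. dist u t < d \<Longrightarrow> dist (y.limit u) (y.limit t) < e"
    using y.continuous_limit unfolding continuous_on_iff by blast
  have near: "norm (y.limit u - y.limit t) \<le> e" if "\<bar>u - t\<bar> < d" for u
    using d(2)[of u] that by (simp add: dist_norm)
  show "\<exists>d>0. \<forall>u. norm (u - t) < d \<longrightarrow>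
      norm (x.limit u - x.limit t - (u - t) *\<^sub>R y.limit t) \<le> e * norm (u - t)"
  \<comment> \<open>One half of \<open>d\<close> bounds the distance of \<open>u\<close> from
    \<open>t\<close>, the other half is the margin passed to \<open>limit_diff_near\<close>; the
    remaining terms keep \<open>u\<close> inside the parameter interval.\<close>
  proof (intro exI[of _ "min (d / 2) (min t (real w - t))"] conjI allI impI)
    show "0 < min (d / 2) (min t (real w - t))" using d t by simp
    fix u assume u: "norm (u - t) < min (d / 2) (min t (real w - t))"
    show "norm (x.limit u - x.limit t - (u - t) *\<^sub>R y.limit t) \<le> e * norm (u - t)"
    proof (cases "t \<le> u")
      case True
      then have "norm (x.limit u - x.limit t - (u - t) *\<^sub>R y.limit t) \<le> (u - t) * e"
        using u t d by (intro limit_diff_near[of t u "d / 2"] near) auto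
      then show ?thesis using True by (simp add: mult.commute)
    next
      case False
      then have "norm (x.limit t - x.limit u - (t - u) *\<^sub>R y.limit t) \<le> (t - u) * e"
        using u t d by (intro limit_diff_near[of u t "d / 2"] near) auto
      moreover have "x.limit t - x.limit u - (t - u) *\<^sub>R y.limit t
          = - (x.limit u - x.limit t - (u - t) *\<^sub>R y.limit t)" by (simp add: algebra_simps)
      ultimately show ?thesis
        using False by (simp add: mult.commute right_diff_distrib del: minus_diff_eq)
    qed
  qed
qed

end

section \<open>Chains whose differences nearly halve under refinement\<close>

lemma norm_bounded_on_finite:
  fixes f :: "nat \<Rightarrow> 'a::real_normed_vector"
  obtains B where "0 \<le> B" "\<And>k. k \<le> N \<Longrightarrow> norm (f k) \<le> B"
proof (rule that[of "\<Sum>k\<le>N. norm (f k)"])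
  show "norm (f k) \<le> (\<Sum>k\<le>N. norm (f k))" if "k \<le> N" for k
    using that by (intro member_le_sum) auto
qed (simp add: sum_nonneg)

text \<open>The interface between schemes and limits. \<open>w\<close> counts the unit parameter
  intervals, and \<open>\<kappa>\<close> stands for a constant multiple of the distortions of the
  iterates.\<close>

locale refined_chain =
  fixes x :: "nat \<Rightarrow> nat \<Rightarrow> 'a::banach" and w L :: nat and \<kappa> :: "nat \<Rightarrow> real" and C :: real
    and d :: "nat \<Rightarrow> nat \<Rightarrow> 'a"
  defines "d \<equiv> \<lambda>l k. x l (Suc k) - x l k"
  assumes diff_refine: "\<And>l k. L \<le> l \<Longrightarrow> k \<le> 2 ^ Suc l * w \<Longrightarrow>
      norm (d (Suc l) k - (1 / 2) *\<^sub>R d l (k div 2)) \<le> \<kappa> l * norm (d l (k div 2))"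
    and diff_neighbour: "\<And>l k. L \<le> l \<Longrightarrow> Suc k \<le> 2 ^ l * w \<Longrightarrow>
      norm (d l (Suc k) - d l k) \<le> \<kappa> l * norm (d l k)"
    and point_refine: "\<And>l k. L \<le> l \<Longrightarrow> k \<le> 2 ^ Suc l * w \<Longrightarrow>
      norm (x (Suc l) k - x l (k div 2)) \<le> C * norm (d l (k div 2))"
    and \<kappa>_nonneg: "\<And>l. L \<le> l \<Longrightarrow> 0 \<le> \<kappa> l" and \<kappa>: "\<kappa> \<longlonglongrightarrow> 0"
    and C: "0 \<le> C" and w: "1 \<le> w"
begin

lemma half_le: "k \<le> 2 ^ Suc l * w \<Longrightarrow> k div 2 \<le> 2 ^ l * w"
  by simp

lemma norm_diff_Suc_le:
  assumes "L \<le> l" "k \<le> 2 ^ Suc l * w"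
  shows "norm (d (Suc l) k) \<le> (1 / 2 + \<kappa> l) * norm (d l (k div 2))"
proof -
  have "norm (d (Suc l) k) \<le> norm ((1 / 2) *\<^sub>R d l (k div 2))
      + norm (d (Suc l) k - (1 / 2) *\<^sub>R d l (k div 2))"
    by (rule norm_triangle_sub)
  also have "\<dots> \<le> (1 / 2) * norm (d l (k div 2)) + \<kappa> l * norm (d l (k div 2))"
    using diff_refine[OF assms] by simp
  finally show ?thesis by (simp add: algebra_simps)
qed

text \<open>Once \<open>\<kappa>\<close> is below \<open>1 / 4\<close>, each level multiplies the
  differences by at most \<open>3 / 4\<close>. Dividing by the power at the starting level
  \<open>L1\<close> absorbs the late start.\<close>

lemma diff_geometric_decay:
  obtains L1 A where "L \<le> L1" "0 \<le> A"
    "\<And>l k. L1 \<le> l \<Longrightarrow> k \<le> 2 ^ l * w \<Longrightarrow> norm (d l k) \<le> A * (3 / 4) ^ l"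
proof -
  have "\<forall>\<^sub>F l in sequentially. \<kappa> l < 1 / 4"
    using \<kappa> by (rule order_tendstoD) simp
  then obtain L0 where L0: "\<And>l. L0 \<le> l \<Longrightarrow> \<kappa> l < 1 / 4"
    unfolding eventually_sequentially by blast
  define L1 where "L1 = max L L0"
  obtain B where B: "0 \<le> B" "\<And>k. k \<le> 2 ^ L1 * w \<Longrightarrow> norm (d L1 k) \<le> B"
    by (rule norm_bounded_on_finite[of "2 ^ L1 * w" "d L1"]) (rule that)
  show thesis
  proof (rule that[of L1 "B / (3 / 4) ^ L1"])
    fix l k assume "L1 \<le> l" "k \<le> 2 ^ l * w"
    then show "norm (d l k) \<le> B / (3 / 4) ^ L1 * (3 / 4) ^ l"
    proof (induction l arbitrary: k rule: dec_induct)
      case base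
      then show ?case using B by simp
    next
      case (step l)
      have "norm (d (Suc l) k) \<le> (1 / 2 + \<kappa> l) * norm (d l (k div 2))"
        using step by (intro norm_diff_Suc_le) (auto simp: L1_def)
      also have "\<dots> \<le> (3 / 4) * (B / (3 / 4) ^ L1 * (3 / 4) ^ l)"
        using step.hyps L0[of l] \<kappa>_nonneg[of l] step.IH[OF half_le[OF step.prems]]
        by (intro mult_mono) (auto simp: L1_def)
      finally show ?case by simp
    qed
  qed (use B in \<open>auto simp: L1_def\<close>)
qed

lemma points_step_refinement:
  obtains L1 T \<eta> where "step_refinement x w L1 T \<eta>"
proof -
  obtain L1 A where L1: "L \<le> L1" "0 \<le> A" and
    decay: "\<And>l k. L1 \<le> l \<Longrightarrow> k \<le> 2 ^ l * w \<Longrightarrow> norm (d l k) \<le> A * (3 / 4) ^ l"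
    by (rule diff_geometric_decay) (rule that)
  show thesis
  \<comment> \<open>The factor \<open>4\<close> turns the geometric bound into a decrement:
    \<open>q ^ l - q ^ Suc l = q ^ l / 4\<close> for \<open>q = 3 / 4\<close>.\<close>
  proof (rule that[of L1 "\<lambda>l. 4 * C * A * (3 / 4) ^ l" "\<lambda>l. A * (3 / 4) ^ l"], unfold_locales)
    fix l k assume l: "L1 \<le> l" and k: "k \<le> 2 ^ Suc l * w"
    have "norm (x (Suc l) k - x l (k div 2)) \<le> C * norm (d l (k div 2))"
      using l k L1 by (intro point_refine) auto
    also have "\<dots> \<le> C * (A * (3 / 4) ^ l)"
      using decay[OF l half_le[OF k]] C by (intro mult_left_mono)
    also have "\<dots> = 4 * C * A * (3 / 4) ^ l - 4 * C * A * (3 / 4) ^ Suc l" by simp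
    finally show "norm (x (Suc l) k - x l (k div 2)) \<le> \<dots>" .
  next
    fix l k assume "L1 \<le> l" "Suc k \<le> 2 ^ l * w"
    then show "norm (x l (Suc k) - x l k) \<le> A * (3 / 4) ^ l"
      using decay[of l k] by (simp add: d_def)
  qed (use w in \<open>auto intro!: tendsto_mult_right_zero LIMSEQ_power_zero\<close>)
qed

text \<open>Each level multiplies the scaled differences by at most
  \<open>1 + 2 * \<kappa> l\<close>, and the product of these factors is at most the exponential of
  twice the sum of \<open>\<kappa>\<close>.\<close>

lemma scaled_diff_bounded:
  assumes "summable \<kappa>"
  obtains M where "0 \<le> M" "\<And>l k. L \<le> l \<Longrightarrow> k \<le> 2 ^ l * w \<Longrightarrow> 2 ^ l * norm (d l k) \<le> M"
proof -
  obtain B where B: "0 \<le> B" "\<And>k. k \<le> 2 ^ L * w \<Longrightarrow> norm (d L k) \<le> B"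
    by (rule norm_bounded_on_finite[of "2 ^ L * w" "d L"]) (rule that)
  define S where "S = (\<Sum>j. \<kappa> (j + L))"
  have growth: "2 ^ (L + j) * norm (d (L + j) k) \<le> 2 ^ L * B * exp (\<Sum>i<j. 2 * \<kappa> (i + L))"
    if "k \<le> 2 ^ (L + j) * w" for j k
    using that
  proof (induction j arbitrary: k)
    case 0
    then show ?case using B by simp
  next
    case (Suc j)
    let ?l = "L + j"
    have k: "k \<le> 2 ^ Suc ?l * w" using Suc.prems by simp
    have "2 ^ Suc ?l * norm (d (Suc ?l) k) \<le> 2 ^ Suc ?l * ((1 / 2 + \<kappa> ?l) * norm (d ?l (k div 2)))"
      using norm_diff_Suc_le[OF _ k] by (intro mult_left_mono) auto
    also have "\<dots> = (1 + 2 * \<kappa> ?l) * (2 ^ ?l * norm (d ?l (k div 2)))" by (simp add: algebra_simps)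
    also have "\<dots> \<le> exp (2 * \<kappa> ?l) * (2 ^ L * B * exp (\<Sum>i<j. 2 * \<kappa> (i + L)))"
      using B(1) by (intro mult_mono[OF _ Suc.IH[OF half_le[OF k]]]) auto
    also have "\<dots> = 2 ^ L * B * exp (\<Sum>i<Suc j. 2 * \<kappa> (i + L))"
      by (simp add: exp_add add.commute)
    finally show ?case by simp
  qed
  have sum_le: "(\<Sum>i<j. 2 * \<kappa> (i + L)) \<le> 2 * S" for j
    using assms \<kappa>_nonneg unfolding S_def sum_distrib_left[symmetric]
    by (intro mult_left_mono sum_le_suminf) (auto simp: summable_iff_shift)
  show thesis
  proof (rule that[of "2 ^ L * B * exp (2 * S)"])
    fix l k assume "L \<le> l" "k \<le> 2 ^ l * w"
    then have "2 ^ l * norm (d l k) \<le> 2 ^ L * B * exp (\<Sum>i<l - L. 2 * \<kappa> (i + L))"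
      using growth[of k "l - L"] by simp
    also have "\<dots> \<le> 2 ^ L * B * exp (2 * S)"
      using B sum_le by (intro mult_left_mono) auto
    finally show "2 ^ l * norm (d l k) \<le> 2 ^ L * B * exp (2 * S)" .
  qed (use B in simp)
qed

text \<open>Scaled differences change by at most \<open>2 * M * \<kappa> l\<close> per level. This
  is exactly the decrement of \<open>2 * M\<close> times the tail of the series, which therefore
  serves as majorant and tends to \<open>0\<close>.\<close>

lemma diffs_step_refinement:
  assumes "summable \<kappa>"
  obtains M where "0 \<le> M"
    "step_refinement (\<lambda>l k. 2 ^ l *\<^sub>R d l k) w L (\<lambda>l. 2 * M * (\<Sum>j. \<kappa> (j + l))) (\<lambda>l. M * \<kappa> l)"
proof -
  obtain M where M: "0 \<le> M" "\<And>l k. L \<le> l \<Longrightarrow> k \<le> 2 ^ l * w \<Longrightarrow> 2 ^ l * norm (d l k) \<le> M"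
    by (rule scaled_diff_bounded[OF assms]) (rule that)
  show thesis
  proof (rule that[OF M(1)], unfold_locales)
    fix l k assume l: "L \<le> l" and k: "k \<le> 2 ^ Suc l * w"
    have "2 ^ Suc l *\<^sub>R d (Suc l) k - 2 ^ l *\<^sub>R d l (k div 2)
        = 2 ^ Suc l *\<^sub>R (d (Suc l) k - (1 / 2) *\<^sub>R d l (k div 2))"
      by (simp add: scaleR_diff_right)
    then have "norm (2 ^ Suc l *\<^sub>R d (Suc l) k - 2 ^ l *\<^sub>R d l (k div 2))
        = 2 ^ Suc l * norm (d (Suc l) k - (1 / 2) *\<^sub>R d l (k div 2))" by simp
    also have "\<dots> \<le> 2 ^ Suc l * (\<kappa> l * norm (d l (k div 2)))"
      using diff_refine[OF l k] by (intro mult_left_mono) auto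
    also have "\<dots> = 2 * \<kappa> l * (2 ^ l * norm (d l (k div 2)))" by simp
    also have "\<dots> \<le> 2 * \<kappa> l * M"
      using M(2)[OF l half_le[OF k]] \<kappa>_nonneg[OF l] by (intro mult_left_mono) auto
    also have "\<dots> = 2 * M * (\<Sum>j. \<kappa> (j + l)) - 2 * M * (\<Sum>j. \<kappa> (j + Suc l))"
    proof -
      have "(\<Sum>j. \<kappa> (j + l)) = (\<Sum>j. \<kappa> (j + Suc l)) + \<kappa> l"
        using suminf_split_initial_segment[of "\<lambda>j. \<kappa> (j + l)" 1] assms
        by (simp add: summable_iff_shift)
      then show ?thesis by (simp add: algebra_simps)
    qed
    finally show "norm (2 ^ Suc l *\<^sub>R d (Suc l) k - 2 ^ l *\<^sub>R d l (k div 2)) \<le> \<dots>" .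
  next
    fix l k assume l: "L \<le> l" and k: "Suc k \<le> 2 ^ l * w"
    have "norm (2 ^ l *\<^sub>R d l (Suc k) - 2 ^ l *\<^sub>R d l k) = 2 ^ l * norm (d l (Suc k) - d l k)"
      by (simp flip: scaleR_diff_right)
    also have "\<dots> \<le> 2 ^ l * (\<kappa> l * norm (d l k))"
      using diff_neighbour[OF l k] by (intro mult_left_mono) auto
    also have "\<dots> = \<kappa> l * (2 ^ l * norm (d l k))" by simp
    also have "\<dots> \<le> \<kappa> l * M"
      using M(2)[OF l, of k] \<kappa>_nonneg[OF l] k by (intro mult_left_mono) auto
    finally show "norm (2 ^ l *\<^sub>R d l (Suc k) - 2 ^ l *\<^sub>R d l k) \<le> M * \<kappa> l" by (simp add: mult.commute)
  next
    have "(\<lambda>l. suminf \<kappa> - (\<Sum>j<l. \<kappa> j)) \<longlonglongrightarrow> suminf \<kappa> - suminf \<kappa>"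
      using assms by (intro tendsto_intros summable_LIMSEQ)
    then have "(\<lambda>l. \<Sum>j. \<kappa> (j + l)) \<longlonglongrightarrow> 0"
      using assms by (simp add: suminf_minus_initial_segment)
    then show "(\<lambda>l. 2 * M * (\<Sum>j. \<kappa> (j + l))) \<longlonglongrightarrow> 0" by (rule tendsto_mult_right_zero)
    show "(\<lambda>l. M * \<kappa> l) \<longlonglongrightarrow> 0" using \<kappa> by (rule tendsto_mult_right_zero)
  qed (rule w)
qed

end

section \<open>From dyadic moduli to Hoelder bounds\<close>

lemma ex_dyadic_scale:
  fixes h :: real
  assumes "0 < h" "h \<le> 1 / 2 ^ L"
  obtains l where "L \<le> l" "h \<le> 1 / 2 ^ l" "1 / 2 ^ Suc l < h"
proof -
  have "\<exists>l. 1 / 2 ^ l < h"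
    using real_arch_pow_inv[of h "1 / 2"] assms(1) by (auto simp: power_one_over)
  \<comment> \<open>The level wanted is \<open>k - 1\<close>: by minimality of \<open>k\<close> it
    no longer satisfies the strict inequality, and \<open>h \<le> 1 / 2 ^ L\<close> forces
    \<open>k > L\<close>.\<close>
  define k where "k = (LEAST l. 1 / 2 ^ l < h)"
  have least: "1 / 2 ^ k < h" unfolding k_def using \<open>\<exists>l. 1 / 2 ^ l < h\<close> by (rule LeastI_ex)
  have not_less: "\<not> 1 / 2 ^ l < h" if "l < k" for l
    using that unfolding k_def by (rule not_less_Least)
  have k: "L < k"
  proof (rule ccontr)
    assume "\<not> L < k"
    then have "(1 / 2 ^ L :: real) \<le> 1 / 2 ^ k" by (intro divide_left_mono power_increasing) auto
    then show False using least assms(2) by linarith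
  qed
  then have "\<not> 1 / 2 ^ (k - 1) < h" by (intro not_less) simp
  then show thesis using that[of "k - 1"] k least by simp
qed

text \<open>The bound is applied at the level with \<open>1 / 2 ^ Suc l < h \<le> 1 / 2 ^ l\<close>;
  comparing \<open>h\<close> with the lower end costs the factor
  \<open>2 powr \<alpha>\<close>.\<close>

lemma dyadic_modulus_imp_hoelder:
  fixes \<psi> :: "real \<Rightarrow> 'a::real_normed_vector"
  assumes "\<And>l s t. L \<le> l \<Longrightarrow> \<bar>s - t\<bar> \<le> 1 / 2 ^ l \<Longrightarrow> norm (\<psi> s - \<psi> t) \<le> E * 2 powr (- \<alpha> * real l)"
    and "0 \<le> E" "0 < \<alpha>" and h: "0 < h" "h \<le> 1 / 2 ^ L" and st: "\<bar>s - t\<bar> \<le> h"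
  shows "norm (\<psi> s - \<psi> t) \<le> E * 2 powr \<alpha> * h powr \<alpha>"
proof -
  obtain l where l: "L \<le> l" "h \<le> 1 / 2 ^ l" "1 / 2 ^ Suc l < h"
    by (rule ex_dyadic_scale[OF h]) (rule that)
  have "norm (\<psi> s - \<psi> t) \<le> E * 2 powr (- \<alpha> * real l)" using assms(1)[OF l(1)] st l(2) by simp
  also have "2 powr (- \<alpha> * real l) = 2 powr \<alpha> * (1 / 2 ^ Suc l) powr \<alpha>"
  proof -
    have "(1 / 2 ^ Suc l :: real) = 2 powr (- real (Suc l))"
      by (simp add: powr_minus_divide powr_realpow[symmetric] del: power_Suc of_nat_Suc)
    then show ?thesis by (simp add: powr_powr powr_add[symmetric] algebra_simps)
  qed
  also have "E * (2 powr \<alpha> * (1 / 2 ^ Suc l) powr \<alpha>) \<le> E * (2 powr \<alpha> * h powr \<alpha>)"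
    using l(3) \<open>0 \<le> E\<close> \<open>0 < \<alpha>\<close> by (intro mult_left_mono powr_mono2) auto
  finally show ?thesis by (simp add: mult.assoc)
qed

section \<open>Limit curves of straightened chains\<close>

context refined_chain
begin

lemma differentiable_refinement:
  assumes "summable \<kappa>"
  obtains L1 T \<eta> M where "0 \<le> M"
    "differentiable_step_refinement x w L1 T \<eta> L (\<lambda>l. 2 * M * (\<Sum>j. \<kappa> (j + l))) (\<lambda>l. M * \<kappa> l)"
proof -
  obtain L1 T \<eta> where x: "step_refinement x w L1 T \<eta>"
    by (rule points_step_refinement) (rule that)
  obtain M where M: "0 \<le> M" and
    y: "step_refinement (\<lambda>l k. 2 ^ l *\<^sub>R d l k) w L (\<lambda>l. 2 * M * (\<Sum>j. \<kappa> (j + l))) (\<lambda>l. M * \<kappa> l)"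
    by (rule diffs_step_refinement[OF assms]) (rule that)
  show thesis
    by (rule that[OF M differentiable_step_refinement.intro[OF x y[unfolded d_def]]])
qed

text \<open>Comparison with a geometric series: the tails, which majorise the error of the scaled
  differences, decay at the same rate \<open>q\<close> as \<open>\<kappa>\<close> itself.\<close>

lemma suminf_tail_le:
  assumes B: "\<And>l. L \<le> l \<Longrightarrow> \<kappa> l \<le> B * q ^ l" and q: "0 \<le> q" "q < 1"
  shows "summable \<kappa>" "L \<le> l \<Longrightarrow> (\<Sum>j. \<kappa> (j + l)) \<le> B / (1 - q) * q ^ l"
proof -
  have sq: "(\<lambda>j. B * q ^ l * q ^ j) sums (B * q ^ l * (1 / (1 - q)))" for l
    using q by (intro sums_mult geometric_sums) simp
  have le: "\<kappa> (j + l) \<le> B * q ^ l * q ^ j" "norm (\<kappa> (j + l)) \<le> B * q ^ l * q ^ j" if "L \<le> l" for j l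
    using B[of "j + l"] \<kappa>_nonneg[of "j + l"] that by (simp_all add: power_add mult_ac)
  have s: "summable (\<lambda>j. \<kappa> (j + l))" if "L \<le> l" for l
    using le(2)[OF that] sums_summable[OF sq] by (rule summable_comparison_test'[where N = 0, rotated])
  then show "summable \<kappa>" using summable_iff_shift by blast
  assume l: "L \<le> l"
  have "(\<Sum>j. \<kappa> (j + l)) \<le> B * q ^ l * (1 / (1 - q))"
    by (intro sums_le[OF le(1)[OF l] summable_sums[OF s[OF l]] sq])
  then show "(\<Sum>j. \<kappa> (j + l)) \<le> B / (1 - q) * q ^ l" by (simp add: mult_ac)
qed

end

text \<open>At a dyadic parameter \<open>i / 2 ^ l\<close> the step function takes the value of the
  point \<open>i\<close> itself, so the error is at most \<open>T l\<close>, uniformly in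
  \<open>z\<close>.\<close>

lemma limit_curve_if_step_refinement:
  assumes "step_refinement (\<lambda>l. (!) ((G ^^ l) P)) w L T \<eta>" and width: "param_width n P = real w"
  shows "limit_curve n G P (step_refinement.limit (\<lambda>l. (!) ((G ^^ l) P)) w)"
proof -
  interpret step_refinement "\<lambda>l. (!) ((G ^^ l) P)" w L T \<eta> by (rule assms(1))
  have "(\<lambda>l. SUP i \<in> param_indices (real w) l z.
      ennreal (norm (limit (real i / 2 ^ l) - (G ^^ l) P ! i))) \<longlonglongrightarrow> 0" (is "?S \<longlonglongrightarrow> 0") if "0 < z" for z
  proof (rule tendsto_sandwich[where f = "\<lambda>_. 0" and h = "\<lambda>l. ennreal (T l)"])
    show "\<forall>\<^sub>F l in sequentially. ?S l \<le> ennreal (T l)"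
      using eventually_ge_at_top[of L]
    proof eventually_elim
      case (elim l)
      show ?case
      proof (intro SUP_least ennreal_leI)
        fix i assume "i \<in> param_indices (real w) l z"
        then have "real i \<le> 2 ^ l * real w" using that
          by (auto simp: param_indices_def elim!: order_trans)
        then have "i \<le> 2 ^ l * w"
          by (metis of_nat_le_iff of_nat_mult of_nat_numeral of_nat_power)
        then show "norm (limit (real i / 2 ^ l) - (G ^^ l) P ! i) \<le> T l"
          using limit_dyadic_dist[OF elim] by simp
      qed
    qed
    show "(\<lambda>l. ennreal (T l)) \<longlonglongrightarrow> 0" using tendsto_ennrealI[OF T] by simp
  qed auto
  then show ?thesis using continuous_limit by (simp add: limit_curve_def width)
qed

text \<open>With at least three points the second difference chain is nonempty, so the maximum in
  \<open>chain_norm\<close> is a genuine one.\<close>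

lemma distortion_nonneg:
  assumes "3 \<le> n" "n \<le> length P"
  shows "0 \<le> distortion n P"
proof -
  let ?p = "subchain n 0 P"
  have len: "length ?p = n" using assms by (simp add: subchain_def)
  have ne: "(fdiff ^^ 2) ?p \<noteq> []" using assms len length_fdiff2[of ?p] by auto
  have nonneg: "0 \<le> chain_norm j q" if "(fdiff ^^ j) q \<noteq> []" for j and q :: "'a list"
  proof -
    have "norm (hd ((fdiff ^^ j) q)) \<le> chain_norm j q"
      unfolding chain_norm_def using that by (intro Max_ge) auto
    then show ?thesis using norm_ge_zero order_trans by blast
  qed
  have "0 \<le> rel_distortion ?p"
  proof (cases "\<exists>x \<in> set (fdiff (linear_proj ?p)). x \<noteq> 0")
    case True
    then have "(fdiff ^^ 1) (linear_proj ?p) \<noteq> []" by auto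
    then show ?thesis using nonneg[OF ne] nonneg True by (auto simp: rel_distortion_def)
  qed (simp add: rel_distortion_def)
  then show ?thesis using rel_distortion_le_distortion[of 0 n P] assms by (simp add: order_trans)
qed

section \<open>Iterates of a scheme as refined chains\<close>

context glue
begin

text \<open>The surplus \<open>length P - 2 * m\<close>, which equals
  \<open>length P - n + 1\<close>, doubles exactly in each step.\<close>

lemma length_iterate:
  assumes "n \<le> length P"
  shows "length ((G ^^ l) P) = 2 ^ l * (length P - n + 1) + 2 * m"
proof (induction l)
  case 0
  then show ?case using assms n by simp
next
  case (Suc l)
  have "1 \<le> 2 ^ l * (length P - n + 1)"
    using mult_le_mono[of 1 "2 ^ l" 1 "length P - n + 1"] by simp
  then have "n \<le> length ((G ^^ l) P)" unfolding Suc n by linarith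
  then show ?case using length_G[of "(G ^^ l) P"] n Suc by simp
qed

lemma le_length_iterate:
  assumes "n \<le> length P"
  shows "n \<le> length ((G ^^ l) P)"
proof -
  have "1 \<le> 2 ^ l * (length P - n + 1)"
    using mult_le_mono[of 1 "2 ^ l" 1 "length P - n + 1"] by simp
  then show ?thesis unfolding length_iterate[OF assms] n by linarith
qed

lemma param_width: "n \<le> length P \<Longrightarrow> param_width n P = real (length P - n + 1)"
  by (simp add: param_width_def of_nat_diff)

lemma kappa_seq_nonneg: "n \<le> length P \<Longrightarrow> 0 \<le> kappa_seq n G P l"
  unfolding kappa_seq_def using n m by (intro distortion_nonneg le_length_iterate) auto

lemma iterates_refined_chain:
  assumes P: "n \<le> length P"
    and k: "\<And>l. L0 \<le> l \<Longrightarrow> kappa_seq n G P l = ereal (k l)" "k \<longlonglongrightarrow> 0"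
  obtains L1 K C where "L0 \<le> L1" "0 \<le> K"
    "refined_chain (\<lambda>l. (!) ((G ^^ l) P)) (length P - n + 1) L1 (\<lambda>l. K * k l) C"
proof -
  define w where "w = length P - n + 1"
  \<comment> \<open>A common majorant of the constants \<open>4 * (L + 1) * n ^ 3\<close> from
    \<open>diff_refine\<close> and \<open>4 * 2 * n ^ 3\<close> from
    \<open>diff_neighbour\<close>.\<close>
  define K where "K = 4 * (L + 2) * real n ^ 3"
  define C where "C = 2 * (L + 2 + \<bar>c\<bar>)"
  have "(\<lambda>l. real n ^ 3 * k l) \<longlonglongrightarrow> 0" using k(2) by (rule tendsto_mult_right_zero)
  then have "\<forall>\<^sub>F l in sequentially. real n ^ 3 * k l < r"
    using r(1) by (rule order_tendstoD)
  then obtain L1' where L1': "\<And>l. L1' \<le> l \<Longrightarrow> real n ^ 3 * k l < r"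
    unfolding eventually_sequentially by blast
  define L1 where "L1 = max L0 L1'"
  have len: "length ((G ^^ l) P) = 2 ^ l * w + 2 * m" for l
    using length_iterate[OF P] by (simp add: w_def)
  have nl: "n \<le> length ((G ^^ l) P)" for l by (rule le_length_iterate[OF P])
  have kl: "distortion n ((G ^^ l) P) \<le> ereal (k l)" "real n ^ 3 * k l < r" "0 \<le> k l" if "L1 \<le> l" for l
    using that k(1)[of l] L1' kappa_seq_nonneg[OF P, of l] by (auto simp: L1_def kappa_seq_def)
  have K1: "4 * (L + 1) * real n ^ 3 * k l * z \<le> K * k l * z"
    and K2: "4 * 2 * real n ^ 3 * k l * z \<le> K * k l * z" if "L1 \<le> l" "0 \<le> z" for l z
    using that kl(3)[of l] L unfolding K_def by (intro mult_right_mono; simp)+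
  show thesis
  proof (rule that[of L1 K C], unfold w_def[symmetric], unfold_locales)
    fix l i assume l: "L1 \<le> l" and i: "i \<le> 2 ^ Suc l * w"
    \<comment> \<open>The chain has \<open>2 * m \<ge> 2\<close> points beyond the first
      \<open>2 ^ Suc l * w\<close>, so even the index \<open>2 ^ Suc l * w\<close> has a
      successor.\<close>
    have Suc_i: "Suc i < length (G ((G ^^ l) P))"
      using i m len[of "Suc l"] by simp
    show "norm ((G ^^ Suc l) P ! Suc i - (G ^^ Suc l) P ! i
          - (1 / 2) *\<^sub>R ((G ^^ l) P ! Suc (i div 2) - (G ^^ l) P ! (i div 2)))
        \<le> K * k l * norm ((G ^^ l) P ! Suc (i div 2) - (G ^^ l) P ! (i div 2))"
      using order_trans[OF diff_refine[OF nl kl(1,2)[OF l] Suc_i] K1[OF l norm_ge_zero]] by simp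
    show "norm ((G ^^ Suc l) P ! i - (G ^^ l) P ! (i div 2))
        \<le> C * norm ((G ^^ l) P ! Suc (i div 2) - (G ^^ l) P ! (i div 2))"
      using point_refine[OF nl kl(1,2)[OF l] Suc_lessD[OF Suc_i]] by (simp add: C_def)
  next
    fix l i assume l: "L1 \<le> l" and i: "Suc i \<le> 2 ^ l * w"
    have "Suc (Suc i) < length ((G ^^ l) P)" using i m len[of l] by simp
    then show "norm ((G ^^ l) P ! Suc (Suc i) - (G ^^ l) P ! Suc i - ((G ^^ l) P ! Suc i - (G ^^ l) P ! i))
        \<le> K * k l * norm ((G ^^ l) P ! Suc i - (G ^^ l) P ! i)"
      by (rule order_trans[OF diff_neighbour[OF nl kl(1,2)[OF l]] K2[OF l norm_ge_zero]])
  next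
    show "0 \<le> K * k l" if "L1 \<le> l" for l using kl(3)[OF that] L by (simp add: K_def)
    show "(\<lambda>l. K * k l) \<longlonglongrightarrow> 0" using k(2) by (rule tendsto_mult_right_zero)
  qed (use L in \<open>auto simp: L1_def K_def C_def w_def\<close>)
qed

end

section \<open>From the definition of a scheme to the local estimates\<close>

lemma glue_scheme_imp_glue:
  fixes G :: "(real ^ 'd::{finite,linorder}) list \<Rightarrow> (real ^ 'd::{finite,linorder}) list"
  assumes "glue_scheme n G"
  obtains m c L r g where "glue n m G c L r g"
proof -
  obtain m \<tau> \<nu> g0 g1 where m: "m \<ge> 1" "n = 2 * m + 1"
    and len: "\<And>P. n \<le> length P \<Longrightarrow> length (G P) = 2 * length P - n + 1"
    and sim: "\<And>S P. similarity S \<Longrightarrow> n \<le> length P \<Longrightarrow> G (map S P) = map S (G P)"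
    and loc: "\<And>P i. n \<le> length P \<Longrightarrow> i < length P - m \<Longrightarrow>
          G P ! (2 * i) = g0 (subchain (m + 1) i P) \<and> G P ! (2 * i + 1) = g1 (subchain (m + 1) i P)"
    and C1: "C1_hoelder_near \<nu> g0 (unit_chain (m + 1))" "C1_hoelder_near \<nu> g1 (unit_chain (m + 1))"
    and unit: "G (unit_chain n) =
         map (\<lambda>p. (1/2) *\<^sub>R (p + (real m + \<tau>) *\<^sub>R first_unit)) (unit_chain (n + 1))"
    using assms unfolding glue_scheme_def by blast
  define g where "g \<mu> = (if \<mu> = 0 then g0 else g1)" for \<mu> :: nat
  define c where "c = (real m + \<tau> - 1) / 2"
  have G_nth: "G P ! (2 * i + \<mu>) = g \<mu> (subchain (Suc m) i P)"
    if "n \<le> length P" "i < length P - m" "\<mu> < 2" for P i \<mu>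
    using loc[OF that(1,2)] that(3) by (cases \<mu>) (auto simp: g_def)
  have equivariant: "g \<mu> (map S q) = S (g \<mu> q)"
    if "\<mu> < 2" "similarity S" "length q = Suc m" for \<mu> S q
  proof -
    \<comment> \<open>Equivariance is known for \<open>G\<close> on chains of length at least
      \<open>n\<close>. Padding \<open>q\<close> to \<open>n\<close> points makes it the first
      window of such a chain, so its rule values are the first two points of
      \<open>G Q\<close>.\<close>
    define Q where "Q = q @ replicate m 0"
    have Q: "n \<le> length Q" "subchain (Suc m) 0 Q = q" "subchain (Suc m) 0 (map S Q) = map S q"
      using that(3) m by (auto simp: Q_def subchain_def)
    have "G (map S Q) ! \<mu> = S (G Q ! \<mu>)"
      unfolding sim[OF that(2) Q(1)] using that len[OF Q(1)] Q(1) m by (intro nth_map) simp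
    then show ?thesis using G_nth[of Q 0 \<mu>] G_nth[of "map S Q" 0 \<mu>] Q m that by simp
  qed
  \<comment> \<open>Both sides come from the first two points of \<open>G (unit_chain n)\<close>:
    \<open>(1 + \<mu> + m + \<tau>) / 2 = 1 + (c + \<mu> / 2)\<close>, where the leading
    \<open>1\<close> reflects that the unit chain starts at \<open>first_unit\<close>.\<close>
  have val: "g \<mu> (unit_chain (Suc m)) = (1 + (c + real \<mu> / 2)) *\<^sub>R first_unit" if "\<mu> < 2" for \<mu>
  proof -
    have "subchain (Suc m) 0 (unit_chain n) =
        (unit_chain (Suc m) :: (real ^ 'd::{finite,linorder}) list)"
      using m by (intro nth_equalityI) (auto simp: subchain_def unit_chain_nth)
    then have "g \<mu> (unit_chain (Suc m)) = G (unit_chain n) ! \<mu>"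
      using G_nth[of "unit_chain n" 0 \<mu>] m that by simp
    also have "\<dots> = (1 / 2) *\<^sub>R ((1 + real \<mu>) *\<^sub>R first_unit + (real m + \<tau>) *\<^sub>R first_unit)"
      unfolding unit using that m by (simp add: unit_chain_nth)
    also have "\<dots> = (1 + (c + real \<mu> / 2)) *\<^sub>R first_unit"
      unfolding scaleR_add_left[symmetric] scaleR_scaleR c_def
      by (rule arg_cong[where f = "\<lambda>z. z *\<^sub>R _"]) (simp add: field_simps)
    finally show ?thesis .
  qed
  define near where "near \<mu> L r \<longleftrightarrow> (\<forall>q a v \<delta>. length q = Suc m \<longrightarrow> v \<noteq> 0 \<longrightarrow> \<delta> < r \<longrightarrow>
       (\<forall>j\<le>m. norm (q ! j - (a + real j *\<^sub>R v)) \<le> \<delta> * norm v) \<longrightarrow>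
       norm (g \<mu> q - (a + (c + real \<mu> / 2) *\<^sub>R v)) \<le> L * \<delta> * norm v)" for \<mu> L r
  have ex_near: "\<exists>L r. 0 \<le> L \<and> 0 < r \<and> near \<mu> L r" if "\<mu> < 2" for \<mu>
  proof -
    have "C1_hoelder_near \<nu> (g \<mu>) (unit_chain (Suc m))" using C1 by (simp add: g_def)
    from equivariant_rule_near_linear[OF equivariant[OF that] this val[OF that]]
    show ?thesis unfolding near_def by metis
  qed
  obtain L0 r0 where L0: "0 \<le> L0" "0 < r0" "near 0 L0 r0" using ex_near[of 0] by auto
  obtain L1 r1 where L1: "0 \<le> L1" "0 < r1" "near 1 L1 r1" using ex_near[of 1] by auto
  have "glue n m G c (max L0 L1) (min (1 / 4) (min r0 r1)) g"
  proof
    fix \<mu> :: nat and \<delta> :: real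
      and q :: "(real ^ 'd::{finite,linorder}) list" and a v :: "real ^ 'd::{finite,linorder}"
    assume \<mu>: "\<mu> < 2" and q: "length q = Suc m" "v \<noteq> 0" "\<delta> < min (1 / 4) (min r0 r1)"
      and q_near: "\<And>j. j \<le> m \<Longrightarrow> norm (q ! j - (a + real j *\<^sub>R v)) \<le> \<delta> * norm v"
    \<comment> \<open>Nonnegativity permits enlarging the constant of either rule to their
      maximum.\<close>
    have \<delta>: "0 \<le> \<delta> * norm v" using q_near[of 0] norm_ge_zero order_trans by blast
    have "norm (g \<mu> q - (a + (c + real \<mu> / 2) *\<^sub>R v)) \<le> (if \<mu> = 0 then L0 else L1) * (\<delta> * norm v)"
    proof (cases "\<mu> = 0")
      case True
      then show ?thesis using L0(3)[unfolded near_def, rule_format, of q v \<delta> a] q q_near by (simp add: mult.assoc)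
    next
      case False
      then have "\<mu> = 1" using \<mu> by simp
      then show ?thesis using L1(3)[unfolded near_def, rule_format, of q v \<delta> a] q q_near by (simp add: mult.assoc)
    qed
    also have "\<dots> \<le> max L0 L1 * (\<delta> * norm v)" using \<delta> by (intro mult_right_mono) auto
    finally show "norm (g \<mu> q - (a + (c + real \<mu> / 2) *\<^sub>R v)) \<le> max L0 L1 * \<delta> * norm v"
      by (simp add: mult.assoc)
  qed (use m len G_nth L0 L1 in auto)
  then show thesis by (rule that)
qed

section \<open>Regularity classes of the limit\<close>

context differentiable_step_refinement
begin

lemma curve_deriv_limit: "0 < t \<Longrightarrow> t < real w \<Longrightarrow> curve_deriv 1 x.limit t = y.limit t"
  using vector_derivative_at[OF limit_has_vector_derivative] by (simp add: curve_deriv_def)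

lemma curve_C_limit: "curve_C (real w) 1 x.limit"
  unfolding curve_C_def
proof (intro conjI allI ballI impI)
  fix j :: nat and t assume "j < 1" and t: "t \<in> {0<..<real w}"
  then show "curve_deriv j x.limit differentiable at t"
    using differentiableI_vector[OF limit_has_vector_derivative[of t]] by (simp add: curve_deriv_def)
next
  have "continuous_on {0<..<real w} y.limit"
    using y.continuous_limit by (rule continuous_on_subset) simp
  then show "continuous_on {0<..<real w} (curve_deriv 1 x.limit)"
    by (rule continuous_on_eq) (simp add: curve_deriv_limit del: One_nat_def)
qed

text \<open>The arguments \<open>t + h / 2\<close> and \<open>t - h / 2\<close> stay within
  \<open>z\<close> of the open interval's interior, where the derivative is \<open>y.limit\<close>.
  That function has its modulus on the whole line, so one bound serves every
  \<open>z\<close>.\<close>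

lemma curve_C_hoelder_limit:
  assumes modulus: "\<And>l s t. L0 \<le> l \<Longrightarrow> \<bar>s - t\<bar> \<le> 1 / 2 ^ l \<Longrightarrow>
      norm (y.limit s - y.limit t) \<le> E * 2 powr (- \<alpha> * real l)"
    and E: "0 \<le> E" and \<alpha>: "0 < \<alpha>"
  shows "curve_C_hoelder (real w) 1 \<alpha> x.limit"
proof -
  have bound: "ennreal (h powr - \<alpha>) * modulus (real w) z (curve_deriv 1 x.limit) h \<le> ennreal (E * 2 powr \<alpha>)"
    if z: "0 < z" and h: "0 < h" "h \<le> 1 / 2 ^ L0" for z h
  proof -
    have "modulus (real w) z (curve_deriv 1 x.limit) h \<le> ennreal (E * 2 powr \<alpha> * h powr \<alpha>)"
      unfolding modulus_def curve_norm_def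
    proof (intro SUP_least ennreal_leI)
      fix t assume "t \<in> {z + h / 2..real w - (z + h / 2)}"
      then have "curve_deriv 1 x.limit (t + h / 2) = y.limit (t + h / 2)"
        "curve_deriv 1 x.limit (t - h / 2) = y.limit (t - h / 2)"
        using z h by (auto intro!: curve_deriv_limit simp del: One_nat_def)
      then show "norm (curve_deriv 1 x.limit (t + h / 2) - curve_deriv 1 x.limit (t - h / 2))
          \<le> E * 2 powr \<alpha> * h powr \<alpha>"
        using dyadic_modulus_imp_hoelder[where \<psi> = y.limit and s = "t + h / 2" and t = "t - h / 2",
            OF modulus E \<alpha> h] h by simp
    qed
    then have "ennreal (h powr - \<alpha>) * modulus (real w) z (curve_deriv 1 x.limit) h
        \<le> ennreal (h powr - \<alpha>) * ennreal (E * 2 powr \<alpha> * h powr \<alpha>)"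
      by (rule mult_left_mono) simp
    also have "\<dots> = ennreal (E * 2 powr \<alpha>)"
      using h E by (simp add: ennreal_mult[symmetric] powr_minus field_simps)
    finally show ?thesis .
  qed
  show ?thesis
    unfolding curve_C_hoelder_def
  proof (intro conjI curve_C_limit exI[of _ "1 / 2 ^ L0"] allI impI)
    fix z :: real assume "0 < z"
    then have "(SUP h \<in> {0<..1 / 2 ^ L0}. ennreal (h powr - \<alpha>) * modulus (real w) z (curve_deriv 1 x.limit) h)
        \<le> ennreal (E * 2 powr \<alpha>)"
      by (intro SUP_least bound) auto
    also have "\<dots> < \<infinity>" by simp
    finally show "(SUP h \<in> {0<..1 / 2 ^ L0}. ennreal (h powr - \<alpha>) * modulus (real w) z (curve_deriv 1 x.limit) h) < \<infinity>" .
  qed simp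
qed

end

section \<open>The three regularity statements\<close>

context glue
begin

lemma real_of_kappa_seq:
  "n \<le> length P \<Longrightarrow> kappa_seq n G P l \<noteq> \<infinity> \<Longrightarrow> kappa_seq n G P l = ereal (real_of_ereal (kappa_seq n G P l))"
  using kappa_seq_nonneg[of P l] by (cases "kappa_seq n G P l") auto

lemma convergent_if_straightened:
  assumes P: "n \<le> length P" and str: "straightened n G P"
  shows "convergent_at n G P"
proof -
  have lim: "kappa_seq n G P \<longlonglongrightarrow> ereal 0" using str by (simp add: straightened_def zero_ereal_def)
  then have "\<forall>\<^sub>F l in sequentially. kappa_seq n G P l < 1" by (rule order_tendstoD) simp
  then obtain L0 where "\<And>l. L0 \<le> l \<Longrightarrow> kappa_seq n G P l < 1"
    unfolding eventually_sequentially by blast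
  then have fin: "kappa_seq n G P l = ereal (real_of_ereal (kappa_seq n G P l))" if "L0 \<le> l" for l
    using that by (intro real_of_kappa_seq[OF P]) force
  obtain L1 K C where
    "refined_chain (\<lambda>l. (!) ((G ^^ l) P)) (length P - n + 1) L1 (\<lambda>l. K * real_of_ereal (kappa_seq n G P l)) C"
    by (rule iterates_refined_chain[of P L0, OF P fin lim_real_of_ereal[OF lim]], assumption) (rule that)
  then obtain L2 T \<eta> where "step_refinement (\<lambda>l. (!) ((G ^^ l) P)) (length P - n + 1) L2 T \<eta>"
    by (rule refined_chain.points_step_refinement) (rule that)
  from limit_curve_if_step_refinement[OF this param_width[OF P]]
  show ?thesis unfolding convergent_at_def by blast
qed

lemma C1_if_strongly_straightened:
  assumes P: "n \<le> length P" and str: "strongly_straightened n G P"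
  shows "C_at 1 n G P"
proof -
  let ?k = "\<lambda>l. real_of_ereal (kappa_seq n G P l)"
  obtain L0 where fin: "\<And>l. L0 \<le> l \<Longrightarrow> kappa_seq n G P l \<noteq> \<infinity>" and "summable (\<lambda>l. ?k (l + L0))"
    using str unfolding strongly_straightened_def essentially_summable_def by blast
  \<comment> \<open>Infinite terms below \<open>L0\<close> become the real number \<open>0\<close>,
    so the unshifted real sequence is summable too.\<close>
  then have summable: "summable ?k" using summable_iff_shift[of ?k L0] by blast
  obtain L1 K C where
    rc: "refined_chain (\<lambda>l. (!) ((G ^^ l) P)) (length P - n + 1) L1 (\<lambda>l. K * ?k l) C"
    by (rule iterates_refined_chain[of P L0, OF P real_of_kappa_seq[OF P fin] summable_LIMSEQ_zero[OF summable]], assumption)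
      (rule that)
  obtain L2 T \<eta> L3 T' \<eta>' where
    ref: "differentiable_step_refinement (\<lambda>l. (!) ((G ^^ l) P)) (length P - n + 1) L2 T \<eta> L3 T' \<eta>'"
    by (rule refined_chain.differentiable_refinement[OF rc summable_mult[OF summable]]) (rule that)
  then interpret ref: differentiable_step_refinement "\<lambda>l. (!) ((G ^^ l) P)" "length P - n + 1" L2 T \<eta> L3 T' \<eta>' .
  have "limit_curve n G P ref.x.limit"
    by (rule limit_curve_if_step_refinement[OF ref.x.step_refinement_axioms param_width[OF P]])
  then show ?thesis
    unfolding C_at_def param_width[OF P] using ref.curve_C_limit by blast
qed

lemma C1_hoelder_if_straightened_at_rate:
  assumes P: "n \<le> length P" and str: "straightened_at_rate \<alpha> n G P" and \<alpha>: "0 < \<alpha>"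
  shows "C_hoelder_at 1 \<alpha> n G P"
proof -
  let ?k = "\<lambda>l. real_of_ereal (kappa_seq n G P l)"
  let ?s = "\<lambda>l. ereal (2 powr (real l * \<alpha>)) * kappa_seq n G P l"
  \<comment> \<open>Straightening at rate \<open>\<alpha>\<close> means eventually
    \<open>?k l \<le> B * q ^ l\<close> with this ratio; the tails of the series then decay like
    \<open>q ^ l\<close> as well.\<close>
  define q where "q = 2 powr - \<alpha>"
  have q: "0 < q" "q < 1" using powr_less_mono[of "- \<alpha>" 0 2] \<alpha> by (auto simp: q_def)
  have q_power: "q ^ l = 2 powr (- \<alpha> * real l)" for l
    unfolding q_def by (simp add: powr_realpow[symmetric] powr_powr)
  obtain L0 where fin': "\<And>l. L0 \<le> l \<Longrightarrow> ?s l \<noteq> \<infinity>" and bdd: "bounded ((\<lambda>l. real_of_ereal (?s l)) ` {L0..})"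
    using str unfolding straightened_at_rate_def essentially_bounded_def by blast
  have fin: "kappa_seq n G P l \<noteq> \<infinity>" if "L0 \<le> l" for l
    using fin'[OF that] by auto
  obtain B where B: "\<And>l. L0 \<le> l \<Longrightarrow> \<bar>real_of_ereal (?s l)\<bar> \<le> B"
    using bdd unfolding bounded_iff by auto
  have k_le: "?k l \<le> B * q ^ l" if "L0 \<le> l" for l
  proof -
    have "2 powr (real l * \<alpha>) * ?k l \<le> B" using B[OF that] by simp
    then have "2 powr (- \<alpha> * real l) * (2 powr (real l * \<alpha>) * ?k l) \<le> 2 powr (- \<alpha> * real l) * B"
      by (intro mult_left_mono) auto
    also have "2 powr (- \<alpha> * real l) * (2 powr (real l * \<alpha>) * ?k l) = ?k l"
      by (simp add: mult.assoc[symmetric] powr_add[symmetric] mult.commute[of \<alpha>])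
    finally show ?thesis by (simp add: q_power mult.commute)
  qed
  have k0: "0 \<le> ?k l" for l using kappa_seq_nonneg[OF P, of l] by (rule real_of_ereal_pos)
  have "B \<ge> 0" using B[of L0] by linarith
  have k_lim: "?k \<longlonglongrightarrow> 0"
  proof (rule tendsto_sandwich[where f = "\<lambda>_. 0" and h = "\<lambda>l. B * q ^ l"])
    show "\<forall>\<^sub>F l in sequentially. ?k l \<le> B * q ^ l"
      using k_le by (auto simp: eventually_sequentially)
    show "(\<lambda>l. B * q ^ l) \<longlonglongrightarrow> 0"
      using q by (intro tendsto_mult_right_zero LIMSEQ_power_zero) auto
  qed (use k0 in auto)
  obtain L1 K C where "L0 \<le> L1" "0 \<le> K" and
    rc: "refined_chain (\<lambda>l. (!) ((G ^^ l) P)) (length P - n + 1) L1 (\<lambda>l. K * ?k l) C"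
    by (rule iterates_refined_chain[of P L0, OF P real_of_kappa_seq[OF P fin] k_lim], assumption) (rule that)
  have \<kappa>_le: "K * ?k l \<le> K * B * q ^ l" if "L1 \<le> l" for l
    using mult_left_mono[OF k_le \<open>0 \<le> K\<close>, of l] that \<open>L0 \<le> L1\<close> by (simp add: mult.assoc)
  have summable: "summable (\<lambda>l. K * ?k l)"
    by (rule refined_chain.suminf_tail_le(1)[OF rc \<kappa>_le less_imp_le[OF q(1)] q(2)])
  have tail: "(\<Sum>j. K * ?k (j + l)) \<le> K * B / (1 - q) * q ^ l" if "L1 \<le> l" for l
    using that by (rule refined_chain.suminf_tail_le(2)[OF rc \<kappa>_le less_imp_le[OF q(1)] q(2), rotated])
  obtain L2 T \<eta> M where M: "0 \<le> M" and
    ref: "differentiable_step_refinement (\<lambda>l. (!) ((G ^^ l) P)) (length P - n + 1) L2 T \<eta> L1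
      (\<lambda>l. 2 * M * (\<Sum>j. K * ?k (j + l))) (\<lambda>l. M * (K * ?k l))"
    by (rule refined_chain.differentiable_refinement[OF rc summable]) (rule that)
  interpret ref: differentiable_step_refinement "\<lambda>l. (!) ((G ^^ l) P)" "length P - n + 1" L2 T \<eta> L1
      "\<lambda>l. 2 * M * (\<Sum>j. K * ?k (j + l))" "\<lambda>l. M * (K * ?k l)" by (rule ref)
  have "limit_curve n G P ref.x.limit"
    by (rule limit_curve_if_step_refinement[OF ref.x.step_refinement_axioms param_width[OF P]])
  moreover have "curve_C_hoelder (real (length P - n + 1)) 1 \<alpha> ref.x.limit"
  \<comment> \<open>The modulus at scale \<open>1 / 2 ^ l\<close> is twice the majorant, itself
    \<open>2 * M\<close> times a tail, plus the neighbour bound \<open>M * (K * ?k l)\<close>; the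
    two summands of the constant bound these in turn.\<close>
  proof (rule ref.curve_C_hoelder_limit[of L1 "4 * M * (K * B / (1 - q)) + M * (K * B)"])
    fix l and s t :: real assume l: "L1 \<le> l" and st: "\<bar>s - t\<bar> \<le> 1 / 2 ^ l"
    have "norm (ref.y.limit s - ref.y.limit t) \<le> 2 * (2 * M * (\<Sum>j. K * ?k (j + l))) + \<bar>M * (K * ?k l)\<bar>"
      by (rule ref.y.limit_modulus[OF l st])
    also have "\<dots> = 4 * M * (\<Sum>j. K * ?k (j + l)) + M * (K * ?k l)"
      using M \<open>0 \<le> K\<close> k0[of l] by simp
    also have "\<dots> \<le> 4 * M * (K * B / (1 - q) * q ^ l) + M * (K * B * q ^ l)"
      using M tail[OF l] \<kappa>_le[OF l] by (intro add_mono mult_left_mono) auto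
    also have "\<dots> = (4 * M * (K * B / (1 - q)) + M * (K * B)) * q ^ l" by (simp add: algebra_simps)
    finally show "norm (ref.y.limit s - ref.y.limit t)
        \<le> (4 * M * (K * B / (1 - q)) + M * (K * B)) * 2 powr (- \<alpha> * real l)"
      unfolding q_power .
  next
    show "0 \<le> 4 * M * (K * B / (1 - q)) + M * (K * B)" using M \<open>0 \<le> K\<close> \<open>0 \<le> B\<close> q by simp
  qed (rule \<alpha>)
  ultimately show ?thesis unfolding C_hoelder_at_def param_width[OF P] by blast
qed

end

theorem theorem5p2:
  fixes G :: "(real ^ 'd::{finite,linorder}) list \<Rightarrow> (real ^ 'd::{finite,linorder}) list"
    and P :: "(real ^ 'd::{finite,linorder}) list" and n :: nat and \<alpha> :: real
  assumes "glue_scheme n G" and "n \<le> length P" and "0 < \<alpha>" and "\<alpha> \<le> 1"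
  shows "(straightened n G P \<longrightarrow> convergent_at n G P) \<and>
         (strongly_straightened n G P \<longrightarrow> C_at 1 n G P) \<and>
         (straightened_at_rate \<alpha> n G P \<longrightarrow> C_hoelder_at 1 \<alpha> n G P)"
proof -
  obtain m c L r g where "glue n m G c L r g"
    by (rule glue_scheme_imp_glue[OF assms(1)]) (rule that)
  then interpret glue n m G c L r g .
  show ?thesis
    using convergent_if_straightened C1_if_strongly_straightened C1_hoelder_if_straightened_at_rate assms
    by blast
qed

end
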